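(* Let $p \in [1, \infty]$, $A \in \mathbb{R}^{n \times n}$, and $\varepsilon > 0$. For all sufficiently large $n \gtrsim \varepsilon^{-2}$, any randomized, adaptive algorithm, accessing $A$ only through forward matrix-vector products $x \mapsto Ax$, that estimates $\|A\|_{S_p}$ to relative accuracy $\varepsilon$ with constant success probability on every $A$ must use $q = \Omega(\varepsilon^{-2})$ forward matrix-vector products.
   Context: For $1 \le p < \infty$, $\|A\|_{S_p} = \left(\sum_i \sigma_i(A)^p\right)^{1/p}$ is the Schatten-$p$ norm, where $\sigma_i(A)$ are the singular values of $A$; for $p = \infty$, $\|A\|_{S_\infty}$ is the spectral norm. Estimating $\|A\|_{S_p}$ to relative accuracy $\varepsilon$ means outputting a number $\widehat{a}$ with $|\widehat{a} - \|A\|_{S_p}| \le \varepsilon \|A\|_{S_p}$. Query model: the unknown matrix $A$ is accessed only through an oracle that returns $Ax$ for any query vector $x \in \mathbb{R}^n$ (a forward matrix-vector product); there is no access to $A^\top$ or to the entries of $A$. An algorithm using $q$ queries chooses $x_1, \dots, x_q \in \mathbb{R}^n$ adaptively, each $x_i$ possibly depending on the previous queries and responses and on internal randomness; after observing the transcript $(x_1, Ax_1), \dots, (x_q, Ax_q)$ it outputs its estimate. Internal computation is unrestricted. The symbols $\gtrsim$ and $\Omega$ denote inequalities that hold up to positive constant factors.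
   Formalization: The accuracy is restricted to 0 < ε < 1, since for ε ≥ 1 outputting 0 with no queries always succeeds; the algorithm's queries and estimate are required to be jointly measurable in the internal randomness and the transcript. *)

theory Defs
  imports
    "HOL-Probability.Probability"
    "Jordan_Normal_Form.Char_Poly"
begin

text \<open>
  Square roots of the eigenvalues of \<open>A\<^sup>T A\<close>, with algebraic multiplicity.  Since
  \<open>A\<^sup>T A\<close> is symmetric positive semidefinite, its characteristic polynomial splits over the
  reals, so a real matrix with \<open>n\<close> columns has exactly \<open>n\<close> singular values.
\<close>

definition singular_values :: "real mat \<Rightarrow> real multiset" where
  "singular_values A = image_mset sqrt (proots (char_poly (transpose_mat A * A)))"

text \<open>For \<open>p = \<infinity>\<close> this is the spectral norm; \<open>Max\<close> is meaningful as soon as \<open>A\<close> has a column.\<close>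

definition schatten_norm :: "ereal \<Rightarrow> real mat \<Rightarrow> real" where
  "schatten_norm p A =
     (if p = \<infinity> then Max (set_mset (singular_values A))
      else (\<Sum>\<sigma>\<in>#singular_values A. \<sigma> powr real_of_ereal p) powr (1 / real_of_ereal p))"

text \<open>The Borel \<open>\<sigma>\<close>-algebra on \<open>\<real>\<^sup>n\<close>, transported to \<^term>\<open>carrier_vec n\<close>.\<close>

definition vec_borel :: "nat \<Rightarrow> real vec measure" where
  "vec_borel n =
     vimage_algebra (carrier_vec n) (\<lambda>v. \<lambda>i\<in>{..<n}. vec_index v i) (\<Pi>\<^sub>M i\<in>{..<n}. borel)"

text \<open>
  A transcript of length \<open>k\<close> is the family of the first \<open>k\<close> query--response pairs
  \<open>(x\<^sub>i, A x\<^sub>i)\<close>, \<open>i < k\<close>, undefined outside \<open>{..<k}\<close>.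
\<close>

definition transcript_space :: "nat \<Rightarrow> nat \<Rightarrow> (nat \<Rightarrow> real vec \<times> real vec) measure" where
  "transcript_space n k = (\<Pi>\<^sub>M i\<in>{..<k}. vec_borel n \<Otimes>\<^sub>M vec_borel n)"

text \<open>
  The seed \<open>\<omega>\<close>, drawn from an arbitrary probability space, is all the internal randomness.
  \<open>next_query alg i \<omega> h\<close> is the query issued after the transcript \<open>h\<close> of length \<open>i\<close>, and
  \<open>estimate alg \<omega> h\<close> is the output on the final transcript \<open>h\<close>.
\<close>

record 'r matvec_alg =
  seed_space :: "'r measure"
  next_query :: "nat \<Rightarrow> 'r \<Rightarrow> (nat \<Rightarrow> real vec \<times> real vec) \<Rightarrow> real vec"
  estimate :: "'r \<Rightarrow> (nat \<Rightarrow> real vec \<times> real vec) \<Rightarrow> real"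

text \<open>
  Joint measurability in seed and transcript is the only restriction on the internal computation.
  It cannot be weakened to measurability in the seed for each fixed \<open>A\<close>: well-order the matrices in
  the order type of the continuum and let a random seed pick one of them in such a way that
  sets of fewer than continuum many matrices are null.  For any fixed \<open>A\<close>, almost surely \<open>A\<close>
  precedes the chosen matrix, and a single query can separate all the predecessors.
\<close>

definition matvec_algorithm :: "nat \<Rightarrow> nat \<Rightarrow> 'r matvec_alg \<Rightarrow> bool" where
  "matvec_algorithm n q alg \<longleftrightarrow>
     prob_space (seed_space alg) \<and>
     (\<forall>i<q. (\<lambda>(\<omega>, h). next_query alg i \<omega> h)
        \<in> seed_space alg \<Otimes>\<^sub>M transcript_space n i \<rightarrow>\<^sub>M vec_borel n) \<and>
     (\<lambda>(\<omega>, h). estimate alg \<omega> h) \<in> seed_space alg \<Otimes>\<^sub>M transcript_space n q \<rightarrow>\<^sub>M borel"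

primrec transcript ::
  "'r matvec_alg \<Rightarrow> real mat \<Rightarrow> 'r \<Rightarrow> nat \<Rightarrow> (nat \<Rightarrow> real vec \<times> real vec)" where
  "transcript alg A \<omega> 0 = (\<lambda>_. undefined)"
| "transcript alg A \<omega> (Suc i) =
     (let h = transcript alg A \<omega> i; x = next_query alg i \<omega> h in h(i := (x, A *\<^sub>v x)))"

definition success_prob :: "ereal \<Rightarrow> real \<Rightarrow> nat \<Rightarrow> 'r matvec_alg \<Rightarrow> real mat \<Rightarrow> real" where
  "success_prob p \<epsilon> q alg A =
     measure (seed_space alg)
       {\<omega> \<in> space (seed_space alg).
          \<bar>estimate alg \<omega> (transcript alg A \<omega> q) - schatten_norm p A\<bar> \<le> \<epsilon> * schatten_norm p A}"

end

theory Submission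
  imports Defs
begin

text \<open>
  Take \<open>A = e\<^sub>1 v\<^sup>T\<close> with a Gaussian vector \<open>v\<close> supported on the first \<open>m \<approx> \<kappa> / \<epsilon>\<^sup>2\<close> coordinates.  Every
  Schatten norm of \<open>A\<close> equals \<open>|v|\<close>, and a forward query \<open>A x\<close> reveals only the number \<open>\<langle>v, x\<rangle>\<close>.  By
  rotation invariance, after \<open>q \<le> m / 2\<close> adaptive queries \<open>|v|\<^sup>2\<close> is a known number plus a chi-square variable with
  \<open>k = m - q \<ge> m / 2\<close> degrees of freedom.  By the central limit theorem this variable does not concentrate on
  windows of length \<open>h \<surd>k\<close> with \<open>h\<close> small, whereas a successful estimate would pin \<open>|v|\<^sup>2\<close> down to a window of length
  \<open>O(\<epsilon> m) = O(\<surd>(\<kappa> m))\<close>.  For \<open>\<epsilon>\<close> bounded away from \<open>0\<close> only \<open>q \<ge> 1\<close> is claimed, which follows from scaling.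
\<close>

section \<open>The Schatten norms of the hard instances\<close>

text \<open>Conjugation by the block swap \<open>?P\<close>, its own inverse, exchanges block rows
  and block columns at once, so the two matrices are similar.\<close>

lemma det_four_block_mat_swap:
  fixes A :: "'a :: idom mat"
  assumes "A \<in> carrier_mat n n" "B \<in> carrier_mat n n" "C \<in> carrier_mat n n" "D \<in> carrier_mat n n"
  shows "det (four_block_mat A B C D) = det (four_block_mat D C B A)"
proof (rule det_similar, rule similar_matI)
  let ?P = "four_block_mat (0\<^sub>m n n) (1\<^sub>m n) (1\<^sub>m n) (0\<^sub>m n n) :: 'a mat"
  show "{four_block_mat A B C D, four_block_mat D C B A, ?P, ?P} \<subseteq> carrier_mat (n + n) (n + n)"
    using assms by auto
  have *: "?P * ?P = 1\<^sub>m (n + n)"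
    by (subst mult_four_block_mat[of _ n n _ n _ n _ _ n _ n]) (auto intro!: four_block_one_mat)
  show "?P * ?P = 1\<^sub>m (n + n)" "?P * ?P = 1\<^sub>m (n + n)" by (fact *)+
  have "?P * four_block_mat D C B A = four_block_mat B A D C"
    using assms by (subst mult_four_block_mat[of _ n n _ n _ n _ _ n _ n]) auto
  also have "four_block_mat B A D C * ?P = four_block_mat A B C D"
    using assms by (subst mult_four_block_mat[of _ n n _ n _ n _ _ n _ n]) auto
  finally show "four_block_mat A B C D = ?P * four_block_mat D C B A * ?P" by simp
qed

text \<open>Sylvester's determinant identity: both polynomials are determinants of the same four
  blocks in two arrangements related by the swap.\<close>

lemma char_poly_mult_commute:
  fixes A :: "'a :: idom mat"
  assumes A: "A \<in> carrier_mat n n" and B: "B \<in> carrier_mat n n"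
  shows "char_poly (A * B) = char_poly (B * A)"
proof -
  let ?h = "map_mat (\<lambda>a. [:a:])" and ?X = "[:0, 1:] \<cdot>\<^sub>m 1\<^sub>m n :: 'a poly mat"
  have X: "?X \<in> carrier_mat n n" by simp
  have cp: "char_poly (C * D) = det (?X - ?h C * ?h D)"
    if "C \<in> carrier_mat n n" "D \<in> carrier_mat n n" for C D
  proof -
    have "char_poly_matrix (C * D) = ?X - ?h (C * D)"
      unfolding char_poly_matrix_def using that by (intro eq_matI) auto
    then show ?thesis
      unfolding char_poly_def using that by (simp add: map_poly_mult)
  qed
  have hA: "?h A \<in> carrier_mat n n" and hB: "?h B \<in> carrier_mat n n" using A B by auto
  have XC: "?X * C = [:0, 1:] \<cdot>\<^sub>m C" "C * ?X = [:0, 1:] \<cdot>\<^sub>m C"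
    if "C \<in> carrier_mat n n" for C
    using that by auto
  have "det (?X - ?h A * ?h B) = det (four_block_mat ?X (?h A) (?h B) (1\<^sub>m n))"
    using hA hB by (subst det_four_block_mat[of _ n]) auto
  also have "\<dots> = det (four_block_mat (1\<^sub>m n) (?h B) (?h A) ?X)"
    using hA hB by (intro det_four_block_mat_swap) auto
  \<comment> \<open>The block formula asks the two lower blocks to commute; here one of them is the
    scalar matrix \<open>?X\<close>.\<close>
  also have "\<dots> = det (?X - ?h B * ?h A)"
    using hA hB XC[OF hA] by (subst det_four_block_mat[of _ n]) auto
  finally show ?thesis using cp A B by simp
qed

section \<open>The rank-one instances and their singular values\<close>

text \<open>\<open>v\<close> is a function on all naturals so that it can be a sample point of a
  product measure. \<open>m\<close> is separate from \<open>n\<close> because the hard dimension is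
  tied to the accuracy, while \<open>n\<close> may be far larger.\<close>

definition first_row_mat :: "nat \<Rightarrow> nat \<Rightarrow> (nat \<Rightarrow> real) \<Rightarrow> real mat" where
  "first_row_mat n m v = mat n n (\<lambda>(i, j). if i = 0 \<and> j < m then v j else 0)"

lemma first_row_mat_carrier [simp]: "first_row_mat n m v \<in> carrier_mat n n"
  by (simp add: first_row_mat_def)

lemma first_row_mat_times_transpose:
  assumes "m \<le> n"
  shows "first_row_mat n m v * transpose_mat (first_row_mat n m v) =
    mat n n (\<lambda>(i, j). if i = 0 \<and> j = 0 then \<Sum>k<m. (v k)\<^sup>2 else 0)"
proof (intro eq_matI)
  fix i j assume "i < dim_row (mat n n (\<lambda>(i, j). if i = 0 \<and> j = 0 then \<Sum>k<m. (v k)\<^sup>2 else 0))"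
    and "j < dim_col (mat n n (\<lambda>(i, j). if i = 0 \<and> j = 0 then \<Sum>k<m. (v k)\<^sup>2 else 0))"
  then have ij: "i < n" "j < n" by auto
  have "(first_row_mat n m v * transpose_mat (first_row_mat n m v)) $$ (i, j) =
      (\<Sum>k = 0..<n. (if i = 0 \<and> k < m then v k else 0) * (if j = 0 \<and> k < m then v k else 0))"
    using ij by (simp add: first_row_mat_def scalar_prod_def)
  also have "\<dots> = (\<Sum>k<m. if i = 0 \<and> j = 0 then (v k)\<^sup>2 else 0)"
    using assms by (intro sum.mono_neutral_cong_right) (auto simp: power2_eq_square)
  finally show "(first_row_mat n m v * transpose_mat (first_row_mat n m v)) $$ (i, j) =
      mat n n (\<lambda>(i, j). if i = 0 \<and> j = 0 then \<Sum>k<m. (v k)\<^sup>2 else 0) $$ (i, j)"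
    using ij by auto
qed (auto simp: first_row_mat_def)

text \<open>\<open>transpose_mat ?A * ?A\<close> is a full rank-one matrix, but the product in the
  other order is diagonal with at most one nonzero entry, and both have the same characteristic
  polynomial.\<close>

lemma singular_values_first_row_mat:
  assumes "m \<le> n" "0 < n"
  shows "singular_values (first_row_mat n m v) =
    add_mset (sqrt (\<Sum>k<m. (v k)\<^sup>2)) (replicate_mset (n - 1) 0)"
proof -
  let ?A = "first_row_mat n m v" and ?r = "\<Sum>k<m. (v k)\<^sup>2"
  let ?D = "mat n n (\<lambda>(i, j). if i = 0 \<and> j = 0 then ?r else 0)"
  have "diag_mat ?D = ?r # replicate (n - 1) 0"
    using assms by (intro nth_equalityI) (auto simp: diag_mat_def nth_Cons')
  then have "char_poly ?D = [:- ?r, 1:] * (\<Prod>a\<leftarrow>replicate (n - 1) 0. [:- a, 1:])"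
    by (subst char_poly_upper_triangular[of _ n]) (auto simp: upper_triangular_def)
  moreover have "char_poly (transpose_mat ?A * ?A) = char_poly ?D"
    using char_poly_mult_commute[of "transpose_mat ?A" n ?A] assms
    by (simp add: first_row_mat_times_transpose)
  ultimately have "char_poly (transpose_mat ?A * ?A) = [:- ?r, 1:] * [:0, 1:] ^ (n - 1)"
    by (simp add: prod_list_replicate)
  then have "proots (char_poly (transpose_mat ?A * ?A)) = add_mset ?r (replicate_mset (n - 1) 0)"
    by (simp only:) (subst proots_mult, auto simp: proots_power)
  then show ?thesis
    by (simp add: singular_values_def)
qed

lemma schatten_norm_first_row_mat:
  assumes "m \<le> n" "0 < n" "1 \<le> p"
  shows "schatten_norm p (first_row_mat n m v) = sqrt (\<Sum>k<m. (v k)\<^sup>2)"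
proof (cases "p = \<infinity>")
  case True
  have "set_mset (singular_values (first_row_mat n m v)) \<subseteq> {sqrt (\<Sum>k<m. (v k)\<^sup>2), 0}"
    using assms by (auto simp: singular_values_first_row_mat)
  with True show ?thesis
    using assms by (auto simp: schatten_norm_def singular_values_first_row_mat sum_nonneg
        intro!: Max_eqI)
next
  case False
  \<comment> \<open>In the sum the zero singular values disappear because
    \<open>0 powr r = 0\<close>.\<close>
  then obtain r where "p = ereal r" "1 \<le> r"
    using assms(3) by (cases p) auto
  then show ?thesis
    using assms by (simp add: schatten_norm_def singular_values_first_row_mat sum_nonneg powr_powr)
qed

lemma first_row_mat_mult_vec:
  assumes "m \<le> n" "x \<in> carrier_vec n"
  shows "first_row_mat n m v *\<^sub>v x =
    vec n (\<lambda>i. if i = 0 then \<Sum>j<m. vec_index x j * v j else 0)"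
proof (intro eq_vecI)
  fix i assume "i < dim_vec (vec n (\<lambda>i. if i = 0 then \<Sum>j<m. vec_index x j * v j else 0))"
  then have i: "i < n" by simp
  have "(first_row_mat n m v *\<^sub>v x) $ i =
      (\<Sum>j = 0..<n. (if i = 0 \<and> j < m then v j else 0) * x $ j)"
    using i assms by (simp add: first_row_mat_def scalar_prod_def)
  also have "\<dots> = (\<Sum>j<m. if i = 0 then x $ j * v j else 0)"
    using assms by (intro sum.mono_neutral_cong_right) auto
  finally show "(first_row_mat n m v *\<^sub>v x) $ i =
      vec n (\<lambda>i. if i = 0 then \<Sum>j<m. x $ j * v j else 0) $ i"
    using i by simp
qed (simp add: first_row_mat_def)

section \<open>Rotation invariance of the Gaussian measure\<close>

text \<open>Two one-dimensional affine substitutions, separated by an exchange of the integrals,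
  replace the planar change of variables; their Jacobians \<open>1 / \<bar>C\<bar>\<close> and
  \<open>\<bar>C\<bar>\<close> cancel.\<close>

lemma nn_integral_std_normal_rotation:
  fixes C S :: real and f :: "real \<times> real \<Rightarrow> ennreal"
  assumes CS: "C\<^sup>2 + S\<^sup>2 = 1" and f [measurable]: "f \<in> borel_measurable (borel \<Otimes>\<^sub>M borel)"
  shows "(\<integral>\<^sup>+x. \<integral>\<^sup>+y. f (C * x - S * y, S * x + C * y) \<partial>std_normal_distribution \<partial>std_normal_distribution)
    = (\<integral>\<^sup>+x. \<integral>\<^sup>+y. f (x, y) \<partial>std_normal_distribution \<partial>std_normal_distribution)"
proof -
  let ?\<phi> = "\<lambda>x. ennreal (std_normal_density x)"
  \<comment> \<open>The two arguments on the left are the inverse rotation of \<open>(u, w)\<close>,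
    and the joint density depends only on the sum of squares.\<close>
  have density: "?\<phi> (S * w + C * u) * ?\<phi> (C * w - S * u) = ?\<phi> u * ?\<phi> w" for u w
  proof -
    have "(S * w + C * u)\<^sup>2 + (C * w - S * u)\<^sup>2 = (C\<^sup>2 + S\<^sup>2) * (u\<^sup>2 + w\<^sup>2)"
      by (simp add: power2_eq_square algebra_simps)
    then have "exp (- (S * w + C * u)\<^sup>2 / 2) * exp (- (C * w - S * u)\<^sup>2 / 2) =
        exp (- u\<^sup>2 / 2) * exp (- w\<^sup>2 / 2)"
      unfolding exp_add[symmetric] CS by (simp add: field_simps)
    then show ?thesis
      by (simp add: std_normal_density_def ennreal_mult'[symmetric])
  qed
  have lhs: "(\<integral>\<^sup>+x. \<integral>\<^sup>+y. f (C * x - S * y, S * x + C * y) \<partial>std_normal_distribution \<partial>std_normal_distribution)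
      = (\<integral>\<^sup>+x. \<integral>\<^sup>+y. ?\<phi> x * ?\<phi> y * f (C * x - S * y, S * x + C * y) \<partial>lborel \<partial>lborel)"
    by (simp add: nn_integral_density nn_integral_cmult[symmetric] mult.assoc)
  have rhs: "(\<integral>\<^sup>+x. \<integral>\<^sup>+y. f (x, y) \<partial>std_normal_distribution \<partial>std_normal_distribution)
      = (\<integral>\<^sup>+x. \<integral>\<^sup>+y. ?\<phi> x * ?\<phi> y * f (x, y) \<partial>lborel \<partial>lborel)"
    by (simp add: nn_integral_density nn_integral_cmult[symmetric] mult.assoc)
  show ?thesis
  proof (cases "C = 0")
    case False
    have x: "(x - S * w) / C = C * x - S * ((w - S * x) / C)" for x w
    proof -
      have "C * x - S * ((w - S * x) / C) = ((C\<^sup>2 + S\<^sup>2) * x - S * w) / C"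
        using False by (simp add: field_simps power2_eq_square)
      then show ?thesis using CS by simp
    qed
    have u: "(w - S * (S * w + C * u)) / C = C * w - S * u" for u w
    proof -
      have "w - S * (S * w + C * u) = (C\<^sup>2 + S\<^sup>2) * w - S * (S * w + C * u)"
        using CS by simp
      also have "\<dots> = C * (C * w - S * u)"
        by (simp add: algebra_simps power2_eq_square)
      finally show ?thesis using False by simp
    qed
    \<comment> \<open>First substitution: at fixed \<open>x\<close>, the new variable is
      \<open>w = S * x + C * y\<close>.\<close>
    have inner: "(\<integral>\<^sup>+y. ?\<phi> x * ?\<phi> y * f (C * x - S * y, S * x + C * y) \<partial>lborel) =
        (\<integral>\<^sup>+w. ennreal (1 / \<bar>C\<bar>) * (?\<phi> x * ?\<phi> ((w - S * x) / C) * f ((x - S * w) / C, w)) \<partial>lborel)" for x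
    proof -
      have *: "- S * x / C + 1 / C * w = (w - S * x) / C" for w by (simp add: diff_divide_distrib)
      have **: "S * x + C * ((w - S * x) / C) = w" for w using False by simp
      define g where "g y = ?\<phi> x * ?\<phi> y * f (C * x - S * y, S * x + C * y)" for y
      have "g \<in> borel_measurable borel" unfolding g_def by measurable
      then have "(\<integral>\<^sup>+y. g y \<partial>lborel) = ennreal \<bar>1 / C\<bar> * (\<integral>\<^sup>+w. g (- S * x / C + 1 / C * w) \<partial>lborel)"
        using False by (intro nn_integral_real_affine) auto
      then show ?thesis
        unfolding * unfolding g_def ** x[symmetric] by (subst nn_integral_cmult) auto
    qed
    \<comment> \<open>Second substitution: at fixed \<open>w\<close>, put
      \<open>x = S * w + C * u\<close>, which makes \<open>u\<close> the first argument of
      \<open>f\<close>.\<close>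
    have outer: "(\<integral>\<^sup>+x. ennreal (1 / \<bar>C\<bar>) * (?\<phi> x * ?\<phi> ((w - S * x) / C) * f ((x - S * w) / C, w)) \<partial>lborel) =
        (\<integral>\<^sup>+u. ?\<phi> u * ?\<phi> w * f (u, w) \<partial>lborel)" for w
    proof -
      have "(\<integral>\<^sup>+x. ennreal (1 / \<bar>C\<bar>) * (?\<phi> x * ?\<phi> ((w - S * x) / C) * f ((x - S * w) / C, w)) \<partial>lborel) =
        ennreal \<bar>C\<bar> * (\<integral>\<^sup>+u. ennreal (1 / \<bar>C\<bar>) * (?\<phi> (S * w + C * u) *
          ?\<phi> ((w - S * (S * w + C * u)) / C) * f ((S * w + C * u - S * w) / C, w)) \<partial>lborel)"
        by (subst nn_integral_real_affine[where c = C and t = "S * w"]) (use False in auto)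
      also have "\<dots> = (\<integral>\<^sup>+u. ennreal \<bar>C\<bar> * ennreal (1 / \<bar>C\<bar>) * (?\<phi> u * ?\<phi> w * f (u, w)) \<partial>lborel)"
        unfolding u density using False by (subst nn_integral_cmult[symmetric]) (auto simp: mult.assoc)
      also have "ennreal \<bar>C\<bar> * ennreal (1 / \<bar>C\<bar>) = 1"
        using False by (simp add: ennreal_mult'[symmetric])
      finally show ?thesis by simp
    qed
    show ?thesis
      unfolding lhs rhs inner
      by (subst lborel_pair.Fubini', measurable, unfold outer, subst lborel_pair.Fubini', measurable)
  next
    \<comment> \<open>A quarter turn: division by \<open>C\<close> is impossible, but the map only
      swaps the coordinates up to sign.\<close>
    case True
    then have "S = 1 \<or> S = - 1" using CS by (simp add: power2_eq_1_iff)
    then have S: "S * S = 1" "\<bar>S\<bar> = 1" by auto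
    then have S': "S \<noteq> 0" by auto
    have inner: "(\<integral>\<^sup>+x. ?\<phi> x * ?\<phi> y * f (- S * y, S * x) \<partial>lborel) =
        (\<integral>\<^sup>+w. ?\<phi> w * ?\<phi> y * f (- S * y, w) \<partial>lborel)" for y
    proof -
      have "S * (S * w) = w" "std_normal_density (S * w) = std_normal_density w" for w
        using S by (auto simp: std_normal_density_def power2_eq_square mult.assoc[symmetric] mult.commute)
      then show ?thesis
        using S S' by (subst nn_integral_real_affine[where c = S and t = 0]) auto
    qed
    have outer: "(\<integral>\<^sup>+y. ?\<phi> w * ?\<phi> y * f (- S * y, w) \<partial>lborel) =
        (\<integral>\<^sup>+u. ?\<phi> u * ?\<phi> w * f (u, w) \<partial>lborel)" for w
    proof -
      have "S * (S * w) = w" "std_normal_density (S * w) = std_normal_density w" for w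
        using S by (auto simp: std_normal_density_def power2_eq_square mult.assoc[symmetric] mult.commute)
      moreover have "std_normal_density (- x) = std_normal_density x" for x
        by (simp add: std_normal_density_def)
      ultimately show ?thesis
        using S S' by (subst nn_integral_real_affine[where c = "- S" and t = 0]) (auto simp: mult.commute)
    qed
    have "(\<integral>\<^sup>+x. \<integral>\<^sup>+y. ?\<phi> x * ?\<phi> y * f (C * x - S * y, S * x + C * y) \<partial>lborel \<partial>lborel) =
        (\<integral>\<^sup>+y. \<integral>\<^sup>+x. ?\<phi> x * ?\<phi> y * f (- S * y, S * x) \<partial>lborel \<partial>lborel)"
      using True by (subst lborel_pair.Fubini') auto
    also have "\<dots> = (\<integral>\<^sup>+w. \<integral>\<^sup>+y. ?\<phi> w * ?\<phi> y * f (- S * y, w) \<partial>lborel \<partial>lborel)"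
      unfolding inner by (subst lborel_pair.Fubini') auto
    also have "\<dots> = (\<integral>\<^sup>+u. \<integral>\<^sup>+w. ?\<phi> u * ?\<phi> w * f (u, w) \<partial>lborel \<partial>lborel)"
      unfolding outer by (subst lborel_pair.Fubini') auto
    finally show ?thesis unfolding lhs rhs .
  qed
qed

section \<open>Gaussian product measures and rotations of a coordinate plane\<close>

abbreviation gauss :: "nat \<Rightarrow> (nat \<Rightarrow> real) measure" where
  "gauss m \<equiv> \<Pi>\<^sub>M i\<in>{..<m}. std_normal_distribution"

lemma prob_space_std_normal: "prob_space std_normal_distribution"
  using real_dist_normal_dist by (simp add: real_distribution_def)

lemma product_prob_space_std_normal: "product_prob_space (\<lambda>_ :: nat. std_normal_distribution)"
  by (intro product_prob_spaceI prob_space_std_normal)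

lemma prob_space_gauss: "prob_space (gauss m)"
  by (intro prob_space_PiM prob_space_std_normal)

text \<open>A Givens rotation when \<open>i \<noteq> j\<close> and
  \<open>C\<^sup>2 + S\<^sup>2 = 1\<close>. Cosine and sine replace the angle because later they
  arise directly as quotients of query components.\<close>

definition plane_rotation :: "nat \<Rightarrow> nat \<Rightarrow> real \<Rightarrow> real \<Rightarrow> (nat \<Rightarrow> real) \<Rightarrow> nat \<Rightarrow> real" where
  "plane_rotation i j C S z = z(i := C * z i - S * z j, j := S * z i + C * z j)"

lemma sets_std_normal_PiM [measurable_cong]:
  "sets (\<Pi>\<^sub>M i\<in>I. std_normal_distribution) = sets (\<Pi>\<^sub>M i\<in>I. borel)"
  by (intro sets_PiM_cong) auto

lemma measurable_plane_rotation:
  assumes "i \<in> I" "j \<in> I"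
  shows "plane_rotation i j C S \<in> (\<Pi>\<^sub>M i\<in>I. std_normal_distribution) \<rightarrow>\<^sub>M (\<Pi>\<^sub>M i\<in>I. std_normal_distribution)"
proof -
  have "(\<lambda>z. z k) \<in> borel_measurable (\<Pi>\<^sub>M i\<in>I. std_normal_distribution)" if "k \<in> I" for k
    using measurable_component_singleton[OF that, of "\<lambda>_. std_normal_distribution"] by simp
  note [measurable] = this[OF assms(1)] this[OF assms(2)]
  have I: "I = insert j (insert i I)" using assms by auto
  have "plane_rotation i j C S \<in> (\<Pi>\<^sub>M i\<in>I. std_normal_distribution) \<rightarrow>\<^sub>M (\<Pi>\<^sub>M i\<in>insert j (insert i I). std_normal_distribution)"
    unfolding plane_rotation_def
    by (intro measurable_fun_upd[where J = "insert i I"] measurable_fun_upd[where J = I]) auto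
  then show ?thesis using I by simp
qed

text \<open>Fubini isolates the coordinates \<open>i\<close> and \<open>j\<close>; with the others
  frozen, the planar identity applies to the section of \<open>A\<close>.\<close>

lemma emeasure_plane_rotation:
  assumes ij: "i \<in> I" "j \<in> I" "i \<noteq> j" and I: "finite I" and CS: "C\<^sup>2 + S\<^sup>2 = 1"
    and A: "A \<in> sets (\<Pi>\<^sub>M i\<in>I. std_normal_distribution)"
  shows "emeasure (\<Pi>\<^sub>M i\<in>I. std_normal_distribution)
      (plane_rotation i j C S -` A \<inter> space (\<Pi>\<^sub>M i\<in>I. std_normal_distribution)) =
    emeasure (\<Pi>\<^sub>M i\<in>I. std_normal_distribution) A"
proof -
  let ?N = std_normal_distribution and ?P = "\<lambda>I :: nat set. \<Pi>\<^sub>M i\<in>I. std_normal_distribution"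
  let ?R = "plane_rotation i j C S"
  interpret std_normal: product_prob_space "\<lambda>_ :: nat. std_normal_distribution" UNIV
    by (rule product_prob_space_std_normal)
  define K where "K = I - {i, j}"
  have K: "I = insert i (insert j K)" "i \<notin> insert j K" "j \<notin> K" "finite K"
    using ij I by (auto simp: K_def)
  have fubini: "(\<integral>\<^sup>+z. f z \<partial>?P I) = (\<integral>\<^sup>+z. \<integral>\<^sup>+x. \<integral>\<^sup>+y. f (z(i := x, j := y)) \<partial>?N \<partial>?N \<partial>?P K)"
    if f: "f \<in> borel_measurable (?P I)" for f
  proof -
    have f': "f \<in> borel_measurable (?P (insert j (insert i K)))"
      using f K(1) by (simp add: insert_commute)
    let ?g = "\<lambda>x. \<integral>\<^sup>+ y. f (x(j := y)) \<partial>?N"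
    have g: "?g \<in> borel_measurable (?P (insert i K))"
    proof -
      have "(\<lambda>(x, y). f (x(j := y))) \<in> borel_measurable (?P (insert i K) \<Otimes>\<^sub>M ?N)"
        using measurable_compose[OF measurable_add_dim f'] by (simp add: split_beta)
      then show ?thesis
        by (intro sigma_finite_measure.borel_measurable_nn_integral)
           (auto simp: prob_space_imp_sigma_finite prob_space_std_normal)
    qed
    have "I = insert j (insert i K)" using K(1) by auto
    then have "(\<integral>\<^sup>+z. f z \<partial>?P I) = (\<integral>\<^sup>+z. f z \<partial>?P (insert j (insert i K)))" by simp
    also have "\<dots> = (\<integral>\<^sup>+z. ?g z \<partial>?P (insert i K))"
      using K(2-4) ij(3) by (intro std_normal.product_nn_integral_insert f') auto
    also have "\<dots> = (\<integral>\<^sup>+z. \<integral>\<^sup>+x. ?g (z(i := x)) \<partial>?N \<partial>?P K)"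
      using K(2-4) by (intro std_normal.product_nn_integral_insert g) auto
    finally show ?thesis .
  qed
  have ind: "indicator A \<in> borel_measurable (?P I)" using A by simp
  have R: "?R \<in> ?P I \<rightarrow>\<^sub>M ?P I" using ij by (intro measurable_plane_rotation)
  have "emeasure (?P I) (?R -` A \<inter> space (?P I)) = (\<integral>\<^sup>+z. indicator A (?R z) \<partial>?P I)"
    unfolding nn_integral_indicator[OF measurable_sets[OF R A], symmetric]
    by (intro nn_integral_cong) (simp add: indicator_def)
  also have "\<dots> = (\<integral>\<^sup>+z. \<integral>\<^sup>+x. \<integral>\<^sup>+y. indicator A (?R (z(i := x, j := y))) \<partial>?N \<partial>?N \<partial>?P K)"
    using measurable_compose[OF R ind] by (rule fubini)
  also have "\<dots> = (\<integral>\<^sup>+z. \<integral>\<^sup>+x. \<integral>\<^sup>+y. indicator A (z(i := x, j := y)) \<partial>?N \<partial>?N \<partial>?P K)"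
  proof (rule nn_integral_cong)
    fix z assume z: "z \<in> space (?P K)"
    have "(\<lambda>(x, y). z(i := x, j := y)) \<in> borel \<Otimes>\<^sub>M borel \<rightarrow>\<^sub>M ?P (insert j (insert i K))"
      unfolding split_beta using z
      by (intro measurable_fun_upd[where J = "insert i K"] measurable_fun_upd[where J = K]) auto
    moreover have "insert j (insert i K) = I" using K(1) by auto
    ultimately have meas: "(\<lambda>p. indicator A ((\<lambda>(x, y). z(i := x, j := y)) p) :: ennreal) \<in> borel_measurable (borel \<Otimes>\<^sub>M borel)"
      by (intro measurable_compose[OF _ ind]) simp
    have "?R (z(i := x, j := y)) = z(i := C * x - S * y, j := S * x + C * y)" for x y
      using ij by (auto simp: plane_rotation_def fun_eq_iff)
    with nn_integral_std_normal_rotation[OF CS meas]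
    show "(\<integral>\<^sup>+x. \<integral>\<^sup>+y. indicator A (?R (z(i := x, j := y))) \<partial>?N \<partial>?N) =
        (\<integral>\<^sup>+x. \<integral>\<^sup>+y. indicator A (z(i := x, j := y)) \<partial>?N \<partial>?N)"
      by simp
  qed
  also have "\<dots> = emeasure (?P I) A"
    using fubini[OF ind] A by simp
  finally show ?thesis .
qed

section \<open>Adaptive linear queries to a Gaussian vector\<close>

text \<open>
  Some adaptive strategy of \<open>q\<close> linear measurements locates \<open>|v|\<^sup>2\<close> up to \<open>l\<close> for all \<open>v \<in> V\<close>.  The strategy
  need not depend measurably on the responses: only the set \<open>V\<close> is integrated over.
\<close>

primrec pins_norm :: "real \<Rightarrow> nat \<Rightarrow> nat \<Rightarrow> (nat \<Rightarrow> real) set \<Rightarrow> bool" where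
  "pins_norm l m 0 V \<longleftrightarrow>
     (\<forall>v\<in>V. \<forall>w\<in>V. \<bar>(\<Sum>i<m. (v i)\<^sup>2) - (\<Sum>i<m. (w i)\<^sup>2)\<bar> \<le> l)"
| "pins_norm l m (Suc q) V \<longleftrightarrow>
     (\<exists>c. \<forall>t. pins_norm l m q {v\<in>V. (\<Sum>i<m. c i * v i) = t})"

section \<open>Stability of pinned sets under rotations and sections\<close>

lemma sum_split_two:
  fixes f :: "nat \<Rightarrow> real"
  assumes "i < m" "j < m" "i \<noteq> j"
  shows "(\<Sum>k<m. f k) = f i + f j + (\<Sum>k\<in>{..<m} - {i, j}. f k)"
proof -
  have "{..<m} = insert i (insert j ({..<m} - {i, j}))" using assms by auto
  then have "(\<Sum>k<m. f k) = (\<Sum>k\<in>insert i (insert j ({..<m} - {i, j})). f k)" by simp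
  then show ?thesis using assms by simp
qed

lemma sum_power2_plane_rotation:
  assumes "i < m" "j < m" "i \<noteq> j" "C\<^sup>2 + S\<^sup>2 = 1"
  shows "(\<Sum>k<m. (plane_rotation i j C S z k)\<^sup>2) = (\<Sum>k<m. (z k)\<^sup>2)"
proof -
  have "(C * z i - S * z j)\<^sup>2 + (S * z i + C * z j)\<^sup>2 = (C\<^sup>2 + S\<^sup>2) * ((z i)\<^sup>2 + (z j)\<^sup>2)"
    by (simp add: power2_eq_square algebra_simps)
  then show ?thesis
    using assms by (simp add: sum_split_two[of i m j] plane_rotation_def)
qed

text \<open>Replacing \<open>S\<close> by \<open>- S\<close> transposes the rotation, so turning the
  vector amounts to turning the query backwards.\<close>

lemma sum_mult_plane_rotation:
  assumes "i < m" "j < m" "i \<noteq> j"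
  shows "(\<Sum>k<m. c k * plane_rotation i j C S z k) = (\<Sum>k<m. plane_rotation i j C (- S) c k * z k)"
  using assms by (simp add: sum_split_two[of i m j] plane_rotation_def algebra_simps)

text \<open>The strategy for \<open>V\<close> is reused with every query turned by the transposed
  rotation: responses agree and squared norms are preserved.\<close>

lemma pins_norm_rotate:
  assumes "i < m" "j < m" "i \<noteq> j" "C\<^sup>2 + S\<^sup>2 = 1" "pins_norm l m q V"
  shows "pins_norm l m q {z. plane_rotation i j C S z \<in> V}"
  using assms(5)
proof (induction q arbitrary: V)
  case 0
  show ?case
    unfolding pins_norm.simps
  proof (intro ballI)
    fix z w assume "z \<in> {z. plane_rotation i j C S z \<in> V}" "w \<in> {z. plane_rotation i j C S z \<in> V}"
    then have "plane_rotation i j C S z \<in> V" "plane_rotation i j C S w \<in> V" by auto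
    with 0 have "\<bar>(\<Sum>k<m. (plane_rotation i j C S z k)\<^sup>2) - (\<Sum>k<m. (plane_rotation i j C S w k)\<^sup>2)\<bar> \<le> l"
      unfolding pins_norm.simps by blast
    then show "\<bar>(\<Sum>k<m. (z k)\<^sup>2) - (\<Sum>k<m. (w k)\<^sup>2)\<bar> \<le> l"
      by (simp add: sum_power2_plane_rotation[OF assms(1-4)])
  qed
next
  case (Suc q)
  then obtain c where c: "\<And>t. pins_norm l m q {v\<in>V. (\<Sum>k<m. c k * v k) = t}" by auto
  show ?case
    unfolding pins_norm.simps
  proof (intro exI[of _ "plane_rotation i j C (- S) c"] allI)
    fix t
    show "pins_norm l m q {v \<in> {z. plane_rotation i j C S z \<in> V}.
        (\<Sum>k<m. plane_rotation i j C (- S) c k * v k) = t}"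
      using Suc.IH[OF c[of t]] by (simp add: sum_mult_plane_rotation[OF assms(1-3)])
  qed
qed

text \<open>A known last coordinate adds the same \<open>s\<^sup>2\<close> to all squared norms and
  a known amount to each response.\<close>

lemma pins_norm_section:
  assumes "pins_norm l (Suc m) q V"
  shows "pins_norm l m q {z. z(m := s) \<in> V}"
  using assms
proof (induction q arbitrary: V)
  case 0
  show ?case
    unfolding pins_norm.simps
  proof (intro ballI)
    fix z w assume "z \<in> {z. z(m := s) \<in> V}" "w \<in> {z. z(m := s) \<in> V}"
    then have "z(m := s) \<in> V" "w(m := s) \<in> V" by auto
    with 0 have "\<bar>(\<Sum>i<Suc m. ((z(m := s)) i)\<^sup>2) - (\<Sum>i<Suc m. ((w(m := s)) i)\<^sup>2)\<bar> \<le> l"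
      unfolding pins_norm.simps by blast
    then show "\<bar>(\<Sum>i<m. (z i)\<^sup>2) - (\<Sum>i<m. (w i)\<^sup>2)\<bar> \<le> l" by simp
  qed
next
  case (Suc q)
  then obtain c where c: "\<And>t. pins_norm l (Suc m) q {v\<in>V. (\<Sum>k<Suc m. c k * v k) = t}" by auto
  show ?case
    unfolding pins_norm.simps
  proof (intro exI[of _ c] allI)
    fix t
    \<comment> \<open>The response \<open>t\<close> of the shortened query corresponds to the branch
      \<open>t + c m * s\<close> of the original strategy.\<close>
    have "(\<Sum>k<Suc m. c k * (z(m := s)) k) = t + c m * s \<longleftrightarrow> (\<Sum>k<m. c k * z k) = t" for z
      by simp
    then show "pins_norm l m q {v \<in> {z. z(m := s) \<in> V}. (\<Sum>k<m. c k * v k) = t}"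
      using Suc.IH[OF c[of "t + c m * s"]] by (simp add: fun_upd_def)
  qed
qed

lemma pins_norm_mono:
  assumes "pins_norm l m q V" "W \<subseteq> V"
  shows "pins_norm l m q W"
  using assms
proof (induction q arbitrary: V W)
  case 0
  then show ?case by (simp, blast)
next
  case (Suc q)
  then obtain c where c: "\<And>t. pins_norm l m q {v\<in>V. (\<Sum>k<m. c k * v k) = t}" by auto
  have "pins_norm l m q {v\<in>W. (\<Sum>k<m. c k * v k) = t}" for t
    by (rule Suc.IH[OF c[of t]]) (use Suc.prems in auto)
  then show ?case by auto
qed

section \<open>Gaussian measure of pinned sets\<close>

text \<open>Fubini over the last coordinate. The section \<open>W\<close> comes with its
  measurability so that an induction hypothesis about measurable sets can discharge
  \<open>le\<close>.\<close>

lemma emeasure_gauss_Suc_le: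
  assumes V: "V \<in> sets (gauss (Suc m))"
    and le: "\<And>s W. W = {z \<in> space (gauss m). z(m := s) \<in> V} \<Longrightarrow> W \<in> sets (gauss m) \<Longrightarrow>
      emeasure (gauss m) W \<le> b"
  shows "emeasure (gauss (Suc m)) V \<le> b"
proof -
  let ?N = std_normal_distribution
  interpret std_normal: product_prob_space "\<lambda>_ :: nat. std_normal_distribution" UNIV
    by (rule product_prob_space_std_normal)
  have ind: "indicator V \<in> borel_measurable (\<Pi>\<^sub>M i\<in>insert m {..<m}. ?N)"
    using V by (simp add: lessThan_Suc)
  have sec: "{z \<in> space (gauss m). z(m := s) \<in> V} \<in> sets (gauss m)" for s
  proof -
    have "(\<lambda>z. z(m := s)) \<in> gauss m \<rightarrow>\<^sub>M (\<Pi>\<^sub>M i\<in>insert m {..<m}. ?N)"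
      by (intro measurable_fun_upd[where J = "{..<m}"]) auto
    then have "(\<lambda>z. z(m := s)) -` V \<inter> space (gauss m) \<in> sets (gauss m)"
      using V by (intro measurable_sets) (auto simp: lessThan_Suc)
    then show ?thesis by (simp add: vimage_def Int_def conj_commute)
  qed
  have "emeasure (gauss (Suc m)) V = (\<integral>\<^sup>+z. indicator V z \<partial>(\<Pi>\<^sub>M i\<in>insert m {..<m}. ?N))"
    using V by (simp add: lessThan_Suc)
  also have "\<dots> = (\<integral>\<^sup>+s. \<integral>\<^sup>+z. indicator V (z(m := s)) \<partial>gauss m \<partial>?N)"
    using ind by (subst std_normal.product_nn_integral_insert_rev) auto
  also have "\<dots> = (\<integral>\<^sup>+s. emeasure (gauss m) {z \<in> space (gauss m). z(m := s) \<in> V} \<partial>?N)"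
    unfolding nn_integral_indicator[OF sec, symmetric]
    by (intro nn_integral_cong) (simp add: indicator_def)
  also have "\<dots> \<le> (\<integral>\<^sup>+s. b \<partial>?N)"
    using sec by (intro nn_integral_mono le) auto
  also have "\<dots> = b"
    using prob_space.emeasure_space_1[OF prob_space_std_normal] by simp
  finally show ?thesis .
qed

text \<open>
  A query direction \<open>c\<close> is rotated onto the last coordinate axis; conditioning on the last coordinate
  then leaves a Gaussian vector of one dimension less and one query fewer.
\<close>

lemma emeasure_pins_norm_le:
  assumes small: "\<And>u. emeasure (gauss k) {z \<in> space (gauss k). \<bar>(\<Sum>i<k. (z i)\<^sup>2) - u\<bar> \<le> l} \<le> b"
  shows "V \<in> sets (gauss (q + k)) \<Longrightarrow> pins_norm l (q + k) q V \<Longrightarrow> emeasure (gauss (q + k)) V \<le> b"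
proof (induction q arbitrary: V)
  case 0
  show ?case
  proof (cases "V = {}")
    case False
    \<comment> \<open>Any point of \<open>V\<close> can serve as the centre of the window.\<close>
    then obtain w where w: "w \<in> V" by auto
    have "{z \<in> space (gauss k). \<bar>(\<Sum>i<k. (z i)\<^sup>2) - u\<bar> \<le> l} \<in> sets (gauss k)" for u
      by measurable
    moreover have "V \<subseteq> {z \<in> space (gauss k). \<bar>(\<Sum>i<k. (z i)\<^sup>2) - (\<Sum>i<k. (w i)\<^sup>2)\<bar> \<le> l}"
      using 0 w sets.sets_into_space[of V "gauss k"] by auto
    ultimately have "emeasure (gauss k) V \<le>
        emeasure (gauss k) {z \<in> space (gauss k). \<bar>(\<Sum>i<k. (z i)\<^sup>2) - (\<Sum>i<k. (w i)\<^sup>2)\<bar> \<le> l}"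
      by (intro emeasure_mono) auto
    also have "\<dots> \<le> b" by (rule small)
    finally show ?thesis by simp
  qed simp
next
  case (Suc q)
  let ?m = "q + k"
  \<comment> \<open>Inner induction on the number of nonzero query components before the last one;
    \<open>V\<close> varies because each rotation moves it.\<close>
  have along: "emeasure (gauss (Suc ?m)) V \<le> b"
    if "V \<in> sets (gauss (Suc ?m))" "\<And>t. pins_norm l (Suc ?m) q {v\<in>V. (\<Sum>i<Suc ?m. c i * v i) = t}"
    for c V
    using that
  proof (induction "card {i. i < ?m \<and> c i \<noteq> 0}" arbitrary: c V)
    case 0
    then have c: "c i = 0" if "i < ?m" for i using that by auto
    show ?case
    proof (rule emeasure_gauss_Suc_le[OF 0(2)])
      fix s W assume W: "W = {z \<in> space (gauss ?m). z(?m := s) \<in> V}" "W \<in> sets (gauss ?m)"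
      \<comment> \<open>The query sees only the last coordinate, so on the section at
        \<open>s\<close> its response is always \<open>c ?m * s\<close>: one branch covers the whole
        section and a query is saved.\<close>
      have "pins_norm l ?m q {z. z(?m := s) \<in> {v\<in>V. (\<Sum>i<Suc ?m. c i * v i) = c ?m * s}}"
        by (intro pins_norm_section 0)
      also have "{z. z(?m := s) \<in> {v\<in>V. (\<Sum>i<Suc ?m. c i * v i) = c ?m * s}} = {z. z(?m := s) \<in> V}"
        using c by auto
      finally have "pins_norm l ?m q W"
        by (rule pins_norm_mono) (auto simp: W)
      with W(2) show "emeasure (gauss ?m) W \<le> b" by (rule Suc.IH)
    qed
  next
    case (Suc x)
    then have "{i. i < ?m \<and> c i \<noteq> 0} \<noteq> {}" by (metis card.empty nat.distinct(1))
    then obtain i where i: "i < ?m" "c i \<noteq> 0" by auto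
    define r where "r = sqrt ((c i)\<^sup>2 + (c ?m)\<^sup>2)"
    have r: "r\<^sup>2 = (c i)\<^sup>2 + (c ?m)\<^sup>2" "r \<noteq> 0"
      using i by (auto simp: r_def sum_power2_eq_zero_iff)
    \<comment> \<open>Chosen to annihilate component \<open>i\<close> of the turned query and move
      its length into the last component.\<close>
    define C S where "C = c ?m / r" and "S = - c i / r"
    have CS: "C\<^sup>2 + S\<^sup>2 = 1"
    proof -
      have "C\<^sup>2 + S\<^sup>2 = ((c i)\<^sup>2 + (c ?m)\<^sup>2) / r\<^sup>2"
        by (simp add: C_def S_def power_divide add_divide_distrib)
      with r show ?thesis by (simp flip: r(1))
    qed
    let ?d = "plane_rotation i ?m C (- S) c"
    let ?U = "plane_rotation i ?m C S -` V \<inter> space (gauss (Suc ?m))"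
    have "?d i = 0" using i by (simp add: plane_rotation_def C_def S_def)
    then have "{j. j < ?m \<and> ?d j \<noteq> 0} = {j. j < ?m \<and> c j \<noteq> 0} - {i}"
      by (auto simp: plane_rotation_def)
    then have "card {j. j < ?m \<and> ?d j \<noteq> 0} = x"
      using Suc(2) i by simp
    moreover have "?U \<in> sets (gauss (Suc ?m))"
      using i Suc.prems(1) by (intro measurable_sets[OF measurable_plane_rotation]) auto
    moreover have "pins_norm l (Suc ?m) q {v\<in>?U. (\<Sum>j<Suc ?m. ?d j * v j) = t}" for t
    proof (rule pins_norm_mono)
      show "pins_norm l (Suc ?m) q
          {z. plane_rotation i ?m C S z \<in> {v\<in>V. (\<Sum>i<Suc ?m. c i * v i) = t}}"
        using i CS Suc.prems(2) by (intro pins_norm_rotate) auto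
      show "{v\<in>?U. (\<Sum>j<Suc ?m. ?d j * v j) = t} \<subseteq>
          {z. plane_rotation i ?m C S z \<in> {v\<in>V. (\<Sum>i<Suc ?m. c i * v i) = t}}"
        using i by (auto simp: sum_mult_plane_rotation simp del: sum.lessThan_Suc)
    qed
    ultimately have "emeasure (gauss (Suc ?m)) ?U \<le> b"
      by (intro Suc(1)[of ?d]) auto
    moreover have "emeasure (gauss (Suc ?m)) ?U = emeasure (gauss (Suc ?m)) V"
      using i CS Suc.prems(1) by (intro emeasure_plane_rotation) auto
    ultimately show ?case by simp
  qed
  from Suc.prems(2) obtain c where c:
    "\<And>t. pins_norm l (Suc ?m) q {v\<in>V. (\<Sum>i<Suc ?m. c i * v i) = t}"
    by auto
  have "V \<in> sets (gauss (Suc ?m))" using Suc.prems(1) by simp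
  from along[OF this c] show ?case by simp
qed

section \<open>Anti-concentration of the chi-square distribution\<close>

lemma measure_std_normal_Ioc_le:
  assumes "x \<le> y"
  shows "measure std_normal_distribution {x<..y} \<le> y - x"
proof -
  have "std_normal_density t \<le> 1" for t
  proof -
    have "1 \<le> sqrt (2 * pi)" using pi_ge_two by simp
    then have "1 / sqrt (2 * pi) \<le> 1" by simp
    then have "1 / sqrt (2 * pi) * exp (- t\<^sup>2 / 2) \<le> 1 * 1"
      by (intro mult_mono) auto
    then show ?thesis by (simp add: std_normal_density_def)
  qed
  then have "emeasure std_normal_distribution {x<..y} \<le> (\<integral>\<^sup>+t. indicator {x<..y} t \<partial>lborel)"
    by (subst emeasure_density) (auto intro!: nn_integral_mono split: split_indicator simp del: nn_integral_indicator)
  also have "\<dots> = ennreal (y - x)" using assms by simp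
  finally show ?thesis
    using assms by (simp add: measure_def enn2real_leI)
qed

text \<open>An atom would have to fit into arbitrarily short windows of small mass. Continuity
  matters because weak convergence controls distribution functions only at continuity points of the
  limit.\<close>

lemma isCont_cdf_std_normal: "isCont (cdf std_normal_distribution) x"
proof -
  interpret real_distribution std_normal_distribution by (rule real_dist_normal_dist)
  have "measure std_normal_distribution {x} \<le> 0 + e" if "0 < e" for e
  proof -
    have "measure std_normal_distribution {x} \<le> measure std_normal_distribution {x - e<..x}"
      using that by (intro finite_measure_mono) auto
    also have "\<dots> \<le> x - (x - e)" using that by (intro measure_std_normal_Ioc_le) auto
    finally show ?thesis by simp
  qed
  then have "measure std_normal_distribution {x} \<le> 0" by (rule field_le_epsilon)
  then show ?thesis by (simp add: isCont_cdf measure_le_0_iff)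
qed

text \<open>
  The limit law has a bounded density, and on a fixed finite grid the distribution functions
  converge uniformly; a window shorter than the mesh is caught between grid points.
\<close>

lemma weak_conv_std_normal_window:
  fixes \<mu> :: "nat \<Rightarrow> real measure"
  assumes "weak_conv_m \<mu> std_normal_distribution" and rd: "\<And>k. real_distribution (\<mu> k)" and "0 < b"
  obtains h where "0 < h" "\<forall>\<^sub>F k in sequentially. \<forall>u. measure (\<mu> k) {u..u + h} \<le> b"
proof -
  interpret N: real_distribution std_normal_distribution by (rule real_dist_normal_dist)
  let ?F = "cdf std_normal_distribution"
  have conv: "(\<lambda>k. cdf (\<mu> k) x) \<longlonglongrightarrow> ?F x" for x
    using assms(1) isCont_cdf_std_normal by (simp add: weak_conv_m_def weak_conv_def)
  have "\<forall>\<^sub>F i in sequentially. ?F (- real i) < b / 4 \<and> 1 - b / 4 < ?F (real i)"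
    using \<open>0 < b\<close> by (intro eventually_conj order_tendstoD[OF N.cdf_lim_neg_infty]
        order_tendstoD[OF N.cdf_lim_infty_prob]) auto
  \<comment> \<open>Beyond \<open>m\<close> each tail has mass below \<open>b / 4\<close>.\<close>
  then obtain m :: nat where m: "?F (- real m) < b / 4" "1 - b / 4 < ?F (real m)"
    by (auto simp: eventually_sequentially)
  \<comment> \<open>The mesh is \<open>1 / n\<close>; three cells then have Gaussian mass at most
    \<open>3 / n\<close>, within \<open>b / 2\<close>.\<close>
  obtain n :: nat where n: "6 / b < real n" using reals_Archimedean2 by blast
  have n0: "0 < n"
  proof (rule ccontr)
    assume "\<not> 0 < n"
    with n \<open>0 < b\<close> show False by (simp add: divide_less_0_iff)
  qed
  have n3: "3 / real n \<le> b / 2" using n n0 \<open>0 < b\<close> by (simp add: field_simps)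
  \<comment> \<open>The grid extends at least three cells past \<open>m\<close> on both sides, so a
    window whose cells overhang the grid lies in a tail.\<close>
  define J where "J = int ((m + 3) * n)"
  let ?g = "\<lambda>j :: int. real_of_int j / real n"
  have "\<forall>\<^sub>F k in sequentially. \<forall>j\<in>{- J..J}. \<bar>cdf (\<mu> k) (?g j) - ?F (?g j)\<bar> < b / 8"
    using \<open>0 < b\<close> tendstoD[OF conv, of "b / 8"]
    by (intro eventually_ball_finite) (auto simp: dist_real_def)
  then have "\<forall>\<^sub>F k in sequentially. \<forall>u. measure (\<mu> k) {u..u + 1 / real n} \<le> b"
  proof (rule eventually_mono, intro allI)
    fix k u
    assume grid: "\<forall>j\<in>{- J..J}. \<bar>cdf (\<mu> k) (?g j) - ?F (?g j)\<bar> < b / 8"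
    interpret real_distribution "\<mu> k" by (rule rd)
    \<comment> \<open>The shift by one puts the left grid point strictly below \<open>u\<close>, as
      the half-open interval used later requires; three cells still contain the window.\<close>
    define j where "j = \<lfloor>u * real n\<rfloor> - 1"
    have "real_of_int j < u * real n" "u * real n + 1 \<le> real_of_int (j + 3)"
      unfolding j_def by linarith+
    then have j: "?g j < u" "u + 1 / real n \<le> ?g (j + 3)"
      using n0 by (simp_all add: pos_divide_less_eq pos_le_divide_eq distrib_right)
    have J3: "?g (- J + 3) \<le> - real m" "real m \<le> ?g (J - 3)"
      using n0 by (auto simp: J_def field_simps)
    have gmono: "?g i \<le> ?g i'" if "i \<le> i'" for i i'
      using that by (intro divide_right_mono) auto
    have "m + 3 \<le> (m + 3) * n" using n0 by simp
    then have J_ge: "J \<ge> 3" unfolding J_def by linarith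
    have g: "cdf (\<mu> k) (?g i) \<le> ?F (?g i) + b / 8" "?F (?g i) \<le> cdf (\<mu> k) (?g i) + b / 8"
      if "- J \<le> i" "i \<le> J" for i
      using grid[rule_format, of i] that unfolding abs_less_iff by auto
    show "measure (\<mu> k) {u..u + 1 / real n} \<le> b"
    proof (cases "j < - J")
      case True
      have "measure (\<mu> k) {u..u + 1 / real n} \<le> cdf (\<mu> k) (?g (- J + 3))"
        unfolding cdf_def using j gmono[of "j + 3" "- J + 3"] True
        by (intro finite_measure_mono) auto
      also have "\<dots> \<le> ?F (?g (- J + 3)) + b / 8"
        using J_ge by (intro g) auto
      also have "\<dots> \<le> ?F (- real m) + b / 8"
        using N.cdf_nondecreasing[OF J3(1)] by simp
      finally show ?thesis using m \<open>0 < b\<close> by simp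
    next
      case lo: False
      show ?thesis
      proof (cases "J < j + 3")
        case True
        have "measure (\<mu> k) {u..u + 1 / real n} \<le> measure (\<mu> k) (space (\<mu> k) - {..?g (J - 3)})"
          using j gmono[of "J - 3" "j"] True by (intro finite_measure_mono) auto
        also have "\<dots> = 1 - cdf (\<mu> k) (?g (J - 3))"
          by (subst prob_compl) (auto simp: cdf_def)
        also have "\<dots> \<le> 1 - ?F (?g (J - 3)) + b / 8"
          using g(2)[of "J - 3"] J_ge by linarith
        also have "\<dots> \<le> 1 - ?F (real m) + b / 8"
          using N.cdf_nondecreasing[OF J3(2)] by simp
        finally show ?thesis using m \<open>0 < b\<close> by simp
      next
        \<comment> \<open>Inside the grid, the two grid errors cost \<open>b / 4\<close> and the
          three cells \<open>b / 2\<close>.\<close>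
        case hi: False
        have less: "?g j < ?g (j + 3)" using n0 by (simp add: field_simps)
        have "measure (\<mu> k) {u..u + 1 / real n} \<le> measure (\<mu> k) {?g j<..?g (j + 3)}"
          using j by (intro finite_measure_mono) auto
        also have "\<dots> = cdf (\<mu> k) (?g (j + 3)) - cdf (\<mu> k) (?g j)"
          using less by (rule cdf_diff_eq[symmetric])
        also have "\<dots> \<le> ?F (?g (j + 3)) - ?F (?g j) + b / 4"
          using g(1)[of "j + 3"] g(2)[of j] lo hi by linarith
        also have "?F (?g (j + 3)) - ?F (?g j) = measure std_normal_distribution {?g j<..?g (j + 3)}"
          using less by (rule N.cdf_diff_eq)
        also have "\<dots> \<le> ?g (j + 3) - ?g j"
          using less by (intro measure_std_normal_Ioc_le) simp
        also have "\<dots> = 3 / real n" by (simp add: diff_divide_distrib[symmetric])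
        finally show ?thesis using n3 \<open>0 < b\<close> by simp
      qed
    qed
  qed
  with n0 show ?thesis by (intro that[of "1 / real n"]) auto
qed

section \<open>Central limit theorem for the squared norm\<close>

text \<open>The squared coordinates are independent with mean 1 and variance 3 - 1 = 2. One infinite
  product space carries the sums for all \<open>k\<close>.\<close>

lemma clt_sum_squares:
  "weak_conv_m (\<lambda>k. distr (\<Pi>\<^sub>M i\<in>UNIV. std_normal_distribution) borel
      (\<lambda>z :: nat \<Rightarrow> real. (\<Sum>i<k. (z i)\<^sup>2 - 1) / sqrt (real k * (sqrt 2)\<^sup>2)))
    std_normal_distribution"
proof -
  let ?N = std_normal_distribution and ?P = "\<Pi>\<^sub>M i\<in>(UNIV :: nat set). std_normal_distribution"
  interpret P: prob_space ?P by (intro prob_space_PiM prob_space_std_normal)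
  have comp: "distr ?P ?N (\<lambda>z. z i) = ?N" for i
    by (rule product_prob_space.PiM_component[OF product_prob_space_std_normal]) simp
  have [measurable]: "(\<lambda>z. z i) \<in> ?P \<rightarrow>\<^sub>M ?N" for i by simp
  have coord [measurable]: "(\<lambda>z. z i) \<in> borel_measurable ?P" for i
    using measurable_component_singleton[of i UNIV "\<lambda>_. ?N"] by simp
  \<comment> \<open>Independence is read off the joint law: the joint map is the identity, and its
    law is the product of the marginals.\<close>
  have "P.indep_vars (\<lambda>_. borel) (\<lambda>i z. z i) UNIV"
  proof (subst P.indep_vars_iff_distr_eq_PiM)
    have "distr ?P borel (\<lambda>z. z i) = ?N" for i
      using comp[of i] distr_cong[of ?P ?P borel ?N "\<lambda>z. z i" "\<lambda>z. z i"] by simp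
    moreover have "distr ?P (\<Pi>\<^sub>M i\<in>UNIV. borel) (\<lambda>z. \<lambda>i\<in>UNIV. z i) = distr ?P ?P (\<lambda>z. z)"
      by (intro distr_cong) (auto simp: sets_std_normal_PiM)
    ultimately show "distr ?P (\<Pi>\<^sub>M i\<in>UNIV. borel) (\<lambda>z. \<lambda>i\<in>UNIV. z i) =
        (\<Pi>\<^sub>M i\<in>UNIV. distr ?P borel (\<lambda>z. z i))"
      by (simp add: distr_id2)
  qed auto
  then have indep: "P.indep_vars (\<lambda>_. borel) (\<lambda>i z. (z i)\<^sup>2) UNIV"
    by (rule P.indep_vars_compose2) auto
  have int: "integrable ?P (\<lambda>z. g (z i)) \<longleftrightarrow> integrable ?N g"
    "(\<integral>z. g (z i) \<partial>?P) = (\<integral>x. g x \<partial>?N)"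
    if "g \<in> borel_measurable borel" for g :: "real \<Rightarrow> real" and i
    using that integrable_distr_eq[of "\<lambda>z. z i" ?P ?N g] integral_distr[of "\<lambda>z. z i" ?P ?N g]
    by (simp_all add: comp)
  have i2: "integrable ?N (\<lambda>x. x\<^sup>2)" and i4: "integrable ?N (\<lambda>x. x ^ 4)"
    by (rule integrable_std_normal_distribution_moment)+
  have e2: "(\<integral>x. x\<^sup>2 \<partial>?N) = 1" and e4: "(\<integral>x. x ^ 4 \<partial>?N) = 3"
    using std_normal_distribution_even_moments(1)[of 1] std_normal_distribution_even_moments(1)[of 2]
    by (simp_all add: fact_numeral)
  have mean: "P.expectation (\<lambda>z. (z i)\<^sup>2) = 1" for i
    using int(2)[of "\<lambda>x. x\<^sup>2" i] e2 by simp
  show ?thesis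
  proof (rule P.central_limit_theorem[OF indep mean, where \<mu> = "distr ?N borel (\<lambda>x. x\<^sup>2)"])
    show "0 < sqrt (2 :: real)" by simp
    show sq: "integrable ?P (\<lambda>z. ((z i)\<^sup>2)\<^sup>2)" for i
      using int(1)[of "\<lambda>x. x ^ 4" i] i4 by (simp add: power_mult[symmetric])
    show "P.variance (\<lambda>z. (z i)\<^sup>2) = (sqrt 2)\<^sup>2" for i
    proof -
      have "integrable ?P (\<lambda>z. (z i)\<^sup>2)"
        using int(1)[of "\<lambda>x. x\<^sup>2" i] i2 by simp
      moreover have "P.expectation (\<lambda>z. ((z i)\<^sup>2)\<^sup>2) = 3"
        using int(2)[of "\<lambda>x. x ^ 4" i] e4 by (simp add: power_mult[symmetric])
      ultimately show ?thesis
        using P.variance_eq[OF _ sq, of i] mean[of i] by simp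
    qed
    show "distr ?P borel (\<lambda>z. (z i)\<^sup>2) = distr ?N borel (\<lambda>x. x\<^sup>2)" for i
      by (subst comp[of i, symmetric]) (simp add: distr_distr comp_def)
  qed
qed

text \<open>The window bound for standardised sums passes to \<open>gauss k\<close>, the law of the
  first \<open>k\<close> coordinates. Radius \<open>h / 2\<close> gives length \<open>h\<close>,
  whence the halved witness.\<close>

lemma emeasure_gauss_window:
  assumes "0 < b"
  obtains h where "0 < h" "\<forall>\<^sub>F k in sequentially. \<forall>u.
    emeasure (gauss k) {z \<in> space (gauss k). \<bar>(\<Sum>i<k. (z i)\<^sup>2) - u\<bar> \<le> h * sqrt (real k)} \<le> ennreal b"
proof -
  let ?P = "\<Pi>\<^sub>M i\<in>(UNIV :: nat set). std_normal_distribution"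
  let ?X = "\<lambda>k z :: nat \<Rightarrow> real. (\<Sum>i<k. (z i)\<^sup>2 - 1) / sqrt (real k * (sqrt 2)\<^sup>2)"
  interpret P: prob_space ?P by (intro prob_space_PiM prob_space_std_normal)
  have X [measurable]: "?X k \<in> borel_measurable ?P" for k by measurable
  have "real_distribution (distr ?P borel (?X k))" for k
    by (rule P.real_distribution_distr) measurable
  then obtain h where h: "0 < h"
    "\<forall>\<^sub>F k in sequentially. \<forall>u. measure (distr ?P borel (?X k)) {u..u + h} \<le> b"
    by (rule weak_conv_std_normal_window[OF clt_sum_squares _ assms])
  have "emeasure (gauss k) {z \<in> space (gauss k). \<bar>(\<Sum>i<k. (z i)\<^sup>2) - u\<bar> \<le> h / 2 * sqrt (real k)} \<le> ennreal b"
    if k: "0 < k" and le: "\<forall>u. measure (distr ?P borel (?X k)) {u..u + h} \<le> b" for k u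
  proof -
    let ?A = "{z \<in> space (gauss k). \<bar>(\<Sum>i<k. (z i)\<^sup>2) - u\<bar> \<le> h / 2 * sqrt (real k)}"
    \<comment> \<open>Left endpoint of the window after centring by \<open>real k\<close> and
      dividing by the standard deviation \<open>sqrt (real k * 2)\<close>.\<close>
    define c where "c = (u - real k) / sqrt (real k * 2) - h / 2"
    have A: "?A \<in> sets (gauss k)" by measurable
    have "emeasure (gauss k) ?A = emeasure (distr ?P (gauss k) (\<lambda>z. restrict z {..<k})) ?A"
      by (subst product_prob_space.distr_PiM_restrict_finite[OF product_prob_space_std_normal]) auto
    also have "\<dots> = emeasure ?P ((\<lambda>z. restrict z {..<k}) -` ?A \<inter> space ?P)"
      using A by (intro emeasure_distr measurable_restrict_subset) auto
    also have "\<dots> \<le> emeasure ?P (?X k -` {c..c + h} \<inter> space ?P)"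
    proof (rule emeasure_mono)
      show "?X k -` {c..c + h} \<inter> space ?P \<in> sets ?P" by measurable
      show "(\<lambda>z. restrict z {..<k}) -` ?A \<inter> space ?P \<subseteq> ?X k -` {c..c + h} \<inter> space ?P"
      proof
        fix z
        assume "z \<in> (\<lambda>z. restrict z {..<k}) -` ?A \<inter> space ?P"
        then have z: "\<bar>(\<Sum>i<k. (z i)\<^sup>2) - u\<bar> \<le> h / 2 * sqrt (real k)" "z \<in> space ?P" by auto
        have "h / 2 * sqrt (real k) \<le> h / 2 * sqrt (real k * 2)"
          using h by (intro mult_left_mono) auto
        with z(1) have "\<bar>(\<Sum>i<k. (z i)\<^sup>2) - u\<bar> \<le> h / 2 * sqrt (real k * 2)" by simp
        then have "\<bar>((\<Sum>i<k. (z i)\<^sup>2) - u) / sqrt (real k * 2)\<bar> \<le> h / 2"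
          using k by (simp add: abs_divide divide_le_eq)
        moreover have "?X k z = ((\<Sum>i<k. (z i)\<^sup>2) - u) / sqrt (real k * 2) + (u - real k) / sqrt (real k * 2)"
          by (simp add: sum_subtractf add_divide_distrib[symmetric])
        ultimately have "?X k z \<in> {c..c + h}"
          unfolding c_def abs_le_iff atLeastAtMost_iff by linarith
        with z(2) show "z \<in> ?X k -` {c..c + h} \<inter> space ?P" by blast
      qed
    qed
    also have "\<dots> = emeasure (distr ?P borel (?X k)) {c..c + h}"
      by (subst emeasure_distr) auto
    also have "\<dots> = ennreal (measure (distr ?P borel (?X k)) {c..c + h})"
      by (intro finite_measure.emeasure_eq_measure prob_space.finite_measure P.prob_space_distr X)
    also have "\<dots> \<le> ennreal b" using le by (simp add: ennreal_leI)
    finally show ?thesis .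
  qed
  then have "\<forall>\<^sub>F k in sequentially. \<forall>u.
    emeasure (gauss k) {z \<in> space (gauss k). \<bar>(\<Sum>i<k. (z i)\<^sup>2) - u\<bar> \<le> h / 2 * sqrt (real k)} \<le> ennreal b"
    using eventually_conj[OF eventually_gt_at_top[of 0] h(2)] by (auto elim: eventually_mono)
  with h(1) show ?thesis by (intro that[of "h / 2"]) auto
qed

section \<open>Algorithms run on the hard instances\<close>

lemma space_vec_borel: "space (vec_borel n) = carrier_vec n"
  by (simp add: vec_borel_def)

lemma measurable_vec_index:
  assumes "i < n"
  shows "(\<lambda>v. vec_index v i) \<in> borel_measurable (vec_borel n)"
proof -
  have "(\<lambda>v. \<lambda>i\<in>{..<n}. vec_index v i) \<in> vec_borel n \<rightarrow>\<^sub>M (\<Pi>\<^sub>M i\<in>{..<n}. borel :: real measure)"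
    unfolding vec_borel_def by (rule measurable_vimage_algebra1) (auto simp: space_PiM)
  from measurable_compose[OF this measurable_component_singleton[of i]] assms
  show ?thesis by simp
qed

lemma measurable_vec_borel:
  assumes "\<And>x. x \<in> space M \<Longrightarrow> f x \<in> carrier_vec n"
    and "\<And>i. i < n \<Longrightarrow> (\<lambda>x. vec_index (f x) i) \<in> borel_measurable M"
  shows "f \<in> M \<rightarrow>\<^sub>M vec_borel n"
  unfolding vec_borel_def
  by (rule measurable_vimage_algebra2) (use assms in \<open>auto intro!: measurable_restrict\<close>)

text \<open>Lets Fubini be applied to the success event. For a measurable query, each response entry
  is zero or a sum of products of query entries and coordinates of \<open>v\<close>.\<close>

lemma measurable_transcript:
  assumes alg: "matvec_algorithm n q alg" and mn: "m \<le> n" and "k \<le> q"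
  shows "(\<lambda>p. transcript alg (first_row_mat n m (snd p)) (fst p) k)
    \<in> seed_space alg \<Otimes>\<^sub>M gauss m \<rightarrow>\<^sub>M transcript_space n k"
  using \<open>k \<le> q\<close>
proof (induction k)
  case 0
  \<comment> \<open>\<open>\<lambda>_. undefined\<close> is the only point of the product over the
    empty index set.\<close>
  show ?case by (auto simp: transcript_space_def space_PiM)
next
  case (Suc k)
  let ?M = "seed_space alg \<Otimes>\<^sub>M gauss m"
  let ?T = "\<lambda>p. transcript alg (first_row_mat n m (snd p)) (fst p) k"
  let ?x = "\<lambda>p. next_query alg k (fst p) (?T p)"
  have T: "?T \<in> ?M \<rightarrow>\<^sub>M transcript_space n k" using Suc by simp
  have "(\<lambda>(\<omega>, h). next_query alg k \<omega> h) \<in> seed_space alg \<Otimes>\<^sub>M transcript_space n k \<rightarrow>\<^sub>M vec_borel n"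
    using alg Suc.prems by (simp add: matvec_algorithm_def)
  from measurable_compose[OF measurable_Pair[OF measurable_fst T] this]
  have x: "?x \<in> ?M \<rightarrow>\<^sub>M vec_borel n" by simp
  have x_carrier: "?x p \<in> carrier_vec n" if "p \<in> space ?M" for p
    using measurable_space[OF x that] by (simp add: space_vec_borel)
  have "(\<lambda>p. first_row_mat n m (snd p) *\<^sub>v ?x p) \<in> ?M \<rightarrow>\<^sub>M vec_borel n"
  proof (rule measurable_vec_borel)
    fix i assume i: "i < n"
    have coord: "(\<lambda>p. vec_index (?x p) j * snd p j) \<in> borel_measurable ?M" if "j < m" for j
    proof (rule borel_measurable_times)
      show "(\<lambda>p. vec_index (?x p) j) \<in> borel_measurable ?M"
        using that mn by (intro measurable_compose[OF x] measurable_vec_index) simp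
      have "(\<lambda>v. v j) \<in> borel_measurable (gauss m)"
        using that measurable_component_singleton[of j "{..<m}" "\<lambda>_. std_normal_distribution"] by simp
      then show "(\<lambda>p. snd p j) \<in> borel_measurable ?M"
        by (rule measurable_compose[OF measurable_snd])
    qed
    have "(\<lambda>p. if i = 0 then \<Sum>j<m. vec_index (?x p) j * snd p j else 0) \<in> borel_measurable ?M"
      using coord by (cases "i = 0") (auto intro!: borel_measurable_sum)
    then show "(\<lambda>p. vec_index (first_row_mat n m (snd p) *\<^sub>v ?x p) i) \<in> borel_measurable ?M"
      by (rule measurable_cong[THEN iffD1, rotated])
         (simp add: i first_row_mat_mult_vec[OF mn x_carrier])
  qed (rule mult_mat_vec_carrier[OF first_row_mat_carrier x_carrier])
  with x have "(\<lambda>p. (?x p, first_row_mat n m (snd p) *\<^sub>v ?x p)) \<in> ?M \<rightarrow>\<^sub>M vec_borel n \<Otimes>\<^sub>M vec_borel n"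
    by (rule measurable_Pair)
  with T show ?case
    unfolding transcript_space_def transcript.simps Let_def
    by (intro measurable_fun_upd[where J = "{..<k}"]) auto
qed

text \<open>With the seed fixed the algorithm is a deterministic strategy: instances sharing
  \<open>h\<close> receive the same next query, and one scalar response determines how the
  transcript grows. \<open>j\<close> counts the queries still to come.\<close>

lemma pins_norm_transcript:
  assumes alg: "matvec_algorithm n q alg" and mn: "m \<le> n" and \<omega>: "\<omega> \<in> space (seed_space alg)"
    and "j \<le> q" and "V \<subseteq> space (gauss m)"
    and "\<And>v. v \<in> V \<Longrightarrow> transcript alg (first_row_mat n m v) \<omega> (q - j) = h"
    and "\<And>v w. v \<in> V \<Longrightarrow> w \<in> V \<Longrightarrow>
      transcript alg (first_row_mat n m v) \<omega> q = transcript alg (first_row_mat n m w) \<omega> q \<Longrightarrow>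
      \<bar>(\<Sum>i<m. (v i)\<^sup>2) - (\<Sum>i<m. (w i)\<^sup>2)\<bar> \<le> l"
  shows "pins_norm l m j V"
  using assms(4-7)
proof (induction j arbitrary: V h)
  case 0
  then show ?case by auto
next
  case (Suc j)
  define i where "i = q - Suc j"
  have i: "q - j = Suc i" "i < q" using Suc.prems(1) by (auto simp: i_def)
  let ?x = "next_query alg i \<omega> h"
  have "pins_norm l m j {v\<in>V. (\<Sum>k<m. vec_index ?x k * v k) = t}" for t
  proof (rule Suc.IH)
    fix v assume "v \<in> {v\<in>V. (\<Sum>k<m. vec_index ?x k * v k) = t}"
    then have v: "v \<in> V" "(\<Sum>k<m. vec_index ?x k * v k) = t" by auto
    have h: "transcript alg (first_row_mat n m v) \<omega> i = h"
      using Suc.prems(3)[OF v(1)] by (simp add: i_def)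
    \<comment> \<open>That \<open>?x\<close> has dimension \<open>n\<close> follows from
      measurability once \<open>h\<close> is in the transcript space, which an actual instance
      \<open>v\<close> witnesses; hence the argument sits inside the branch.\<close>
    have "(\<omega>, v) \<in> space (seed_space alg \<Otimes>\<^sub>M gauss m)"
      using \<omega> v Suc.prems(2) by (auto simp: space_pair_measure)
    from measurable_space[OF measurable_transcript[OF alg mn] this, of i] i
    have "h \<in> space (transcript_space n i)" by (simp add: h)
    moreover have "(\<lambda>(\<omega>, h). next_query alg i \<omega> h) \<in> seed_space alg \<Otimes>\<^sub>M transcript_space n i \<rightarrow>\<^sub>M vec_borel n"
      using alg i by (simp add: matvec_algorithm_def)
    ultimately have x: "?x \<in> carrier_vec n"
      using \<omega> measurable_space[of _ "seed_space alg \<Otimes>\<^sub>M transcript_space n i" "vec_borel n" "(\<omega>, h)"]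
      by (fastforce simp: space_pair_measure space_vec_borel)
    have "first_row_mat n m v *\<^sub>v ?x = vec n (\<lambda>k. if k = 0 then t else 0)"
      unfolding first_row_mat_mult_vec[OF mn x] v(2) ..
    then show "transcript alg (first_row_mat n m v) \<omega> (q - j) =
        h(i := (?x, vec n (\<lambda>k. if k = 0 then t else 0)))"
      by (simp add: i h Let_def)
  qed (use Suc.prems in auto)
  then show ?case by (auto intro!: exI[of _ "vec_index ?x"])
qed

section \<open>From success probability to anti-concentration\<close>

text \<open>Markov's inequality for a variable of mean \<open>m\<close>. Bounding the norm turns
  relative accuracy into an absolute window.\<close>

lemma emeasure_gauss_bounded_norm:
  assumes "0 < m"
  shows "ennreal (1 / 2) \<le> emeasure (gauss m) {v \<in> space (gauss m). (\<Sum>i<m. (v i)\<^sup>2) \<le> 2 * real m}"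
proof -
  interpret prob_space "gauss m" by (rule prob_space_gauss)
  let ?N = std_normal_distribution
  have coord: "(\<lambda>v. v i) \<in> borel_measurable (gauss m)" if "i < m" for i
    using that measurable_component_singleton[of i "{..<m}" "\<lambda>_. ?N"] by simp
  have "integrable (gauss m) (\<lambda>v. (v i)\<^sup>2) \<and> (\<integral>v. (v i)\<^sup>2 \<partial>gauss m) = 1" if i: "i < m" for i
  proof -
    have comp: "distr (gauss m) ?N (\<lambda>v. v i) = ?N"
      by (rule product_prob_space.PiM_component[OF product_prob_space_std_normal]) (simp add: i)
    have "(\<lambda>v. v i) \<in> gauss m \<rightarrow>\<^sub>M ?N" using i by simp
    then show ?thesis
      using integrable_distr_eq[of "\<lambda>v. v i" "gauss m" ?N "\<lambda>x. x\<^sup>2"]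
        integral_distr[of "\<lambda>v. v i" "gauss m" ?N "\<lambda>x. x\<^sup>2"]
        std_normal_distribution_even_moments[of 1] by (simp add: comp)
  qed
  then have E: "integrable (gauss m) (\<lambda>v. \<Sum>i<m. (v i)\<^sup>2)" "expectation (\<lambda>v. \<Sum>i<m. (v i)\<^sup>2) = real m"
    by (auto simp: Bochner_Integration.integral_sum)
  have "prob {v \<in> space (gauss m). (\<Sum>i<m. (v i)\<^sup>2) \<ge> 2 * real m} \<le> real m / (2 * real m)"
    using integral_Markov_inequality_measure[OF E(1), of "{}" "2 * real m"] assms
    by (simp add: E(2) sum_nonneg)
  then have "prob {v \<in> space (gauss m). (\<Sum>i<m. (v i)\<^sup>2) \<ge> 2 * real m} \<le> 1 / 2"
    using assms by simp
  moreover have "prob {v \<in> space (gauss m). (\<Sum>i<m. (v i)\<^sup>2) > 2 * real m} \<le>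
      prob {v \<in> space (gauss m). (\<Sum>i<m. (v i)\<^sup>2) \<ge> 2 * real m}"
    by (intro finite_measure_mono) auto
  moreover have "prob {v \<in> space (gauss m). \<not> (\<Sum>i<m. (v i)\<^sup>2) > 2 * real m} =
      1 - prob {v \<in> space (gauss m). (\<Sum>i<m. (v i)\<^sup>2) > 2 * real m}"
    by (intro prob_neg) simp
  ultimately have "1 / 2 \<le> prob {v \<in> space (gauss m). (\<Sum>i<m. (v i)\<^sup>2) \<le> 2 * real m}"
    unfolding not_less by linarith
  then show ?thesis
    unfolding emeasure_eq_measure by (rule ennreal_leI)
qed

text \<open>
  Two norms compatible with the same estimate satisfy \<open>\<rho> - \<rho>' \<le> \<epsilon> (\<rho> + \<rho>')\<close>, so a successful run
  confines the squared norm to a window of relative length \<open>O(\<epsilon>)\<close>.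
\<close>

lemma abs_diff_power2_le:
  fixes \<epsilon> e r r' B :: real
  assumes "\<bar>e - r\<bar> \<le> \<epsilon> * r" "\<bar>e - r'\<bar> \<le> \<epsilon> * r'" "0 \<le> \<epsilon>" "0 \<le> r" "0 \<le> r'" "r\<^sup>2 \<le> B" "r'\<^sup>2 \<le> B"
  shows "\<bar>r\<^sup>2 - r'\<^sup>2\<bar> \<le> 4 * \<epsilon> * B"
proof -
  have "\<bar>r - r'\<bar> \<le> \<epsilon> * (r + r')" using assms(1,2) by (simp add: algebra_simps)
  then have "\<bar>r - r'\<bar> * (r + r') \<le> \<epsilon> * (r + r') * (r + r')"
    using assms by (intro mult_right_mono) auto
  also have "\<dots> \<le> \<epsilon> * (2 * r\<^sup>2 + 2 * r'\<^sup>2)"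
    using assms(3) sum_squares_bound[of r r']
    unfolding mult.assoc by (intro mult_left_mono) (auto simp: power2_eq_square algebra_simps)
  also have "\<dots> \<le> \<epsilon> * (4 * B)" using assms by (intro mult_left_mono) auto
  also have "\<bar>r - r'\<bar> * (r + r') = \<bar>r\<^sup>2 - r'\<^sup>2\<bar>"
    using assms by (simp add: power2_eq_square square_diff_square_factored abs_mult mult.commute)
  finally show ?thesis by simp
qed

text \<open>Averaging: success on every matrix gives success on average over Gaussian instances, and
  exchanging integrals bounds this, seed by seed, by the mass of a pinned set. The factor 1/2 pays
  for discarding large norms.\<close>

lemma success_prob_lower_bound:
  assumes alg: "matvec_algorithm n q alg" and mn: "q + k \<le> n" "0 < q + k" and p: "1 \<le> p" and \<epsilon>: "0 \<le> \<epsilon>"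
    and success: "\<forall>A\<in>carrier_mat n n. s \<le> success_prob p \<epsilon> q alg A" and s: "0 \<le> s"
    and small: "\<And>u. emeasure (gauss k)
      {z \<in> space (gauss k). \<bar>(\<Sum>i<k. (z i)\<^sup>2) - u\<bar> \<le> 8 * \<epsilon> * real (q + k)} \<le> ennreal b"
  shows "ennreal (s / 2) \<le> ennreal b"
proof -
  define m where "m = q + k"
  let ?S = "seed_space alg"
  let ?A = "first_row_mat n m"
  let ?r = "\<lambda>v. sqrt (\<Sum>i<m. (v i)\<^sup>2)"
  let ?e = "\<lambda>\<omega> v. estimate alg \<omega> (transcript alg (?A v) \<omega> q)"
  interpret S: prob_space ?S using alg by (simp add: matvec_algorithm_def)
  interpret G: prob_space "gauss m" by (rule prob_space_gauss)
  interpret SG: pair_prob_space ?S "gauss m" ..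
  have norm: "schatten_norm p (?A v) = ?r v" for v
    using mn p by (intro schatten_norm_first_row_mat) (auto simp: m_def)
  have "(\<lambda>(\<omega>, h). estimate alg \<omega> h) \<in> ?S \<Otimes>\<^sub>M transcript_space n q \<rightarrow>\<^sub>M borel"
    using alg by (simp add: matvec_algorithm_def)
  from measurable_compose[OF measurable_Pair[OF measurable_fst measurable_transcript[OF alg, of m q]] this] mn
  have e [measurable]: "(\<lambda>x. ?e (fst x) (snd x)) \<in> borel_measurable (?S \<Otimes>\<^sub>M gauss m)"
    by (simp add: m_def)
  define W where "W = {x \<in> space (?S \<Otimes>\<^sub>M gauss m).
    \<bar>?e (fst x) (snd x) - ?r (snd x)\<bar> \<le> \<epsilon> * ?r (snd x) \<and> (\<Sum>i<m. (snd x i)\<^sup>2) \<le> 2 * real m}"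
  have [measurable]: "(\<lambda>v. \<Sum>i<m. (v i)\<^sup>2) \<in> borel_measurable (gauss m)" by measurable
  have [measurable]: "(\<lambda>x. \<Sum>i<m. (snd x i)\<^sup>2) \<in> borel_measurable (?S \<Otimes>\<^sub>M gauss m)"
    by (rule measurable_compose[OF measurable_snd]) measurable
  have W: "W \<in> sets (?S \<Otimes>\<^sub>M gauss m)" unfolding W_def by measurable
  let ?B = "{v \<in> space (gauss m). (\<Sum>i<m. (v i)\<^sup>2) \<le> 2 * real m}"
  have "ennreal (s / 2) = ennreal s * ennreal (1 / 2)"
    using ennreal_mult'[OF s, of "1 / 2"] by (simp only: mult_1_right times_divide_eq_right)
  also have "\<dots> \<le> ennreal s * emeasure (gauss m) ?B"
    using mn by (intro mult_left_mono emeasure_gauss_bounded_norm) (auto simp: m_def)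
  also have "\<dots> = (\<integral>\<^sup>+v. ennreal s * indicator ?B v \<partial>gauss m)"
    by (subst nn_integral_cmult_indicator) auto
  also have "\<dots> \<le> (\<integral>\<^sup>+v. emeasure ?S ((\<lambda>\<omega>. (\<omega>, v)) -` W) \<partial>gauss m)"
  proof (rule nn_integral_mono)
    fix v assume v: "v \<in> space (gauss m)"
    show "ennreal s * indicator ?B v \<le> emeasure ?S ((\<lambda>\<omega>. (\<omega>, v)) -` W)"
    proof (cases "v \<in> ?B")
      case True
      have "(\<lambda>\<omega>. (\<omega>, v)) -` W = {\<omega> \<in> space ?S. \<bar>?e \<omega> v - schatten_norm p (?A v)\<bar> \<le> \<epsilon> * schatten_norm p (?A v)}"
        using True by (auto simp: W_def norm space_pair_measure)
      then have "emeasure ?S ((\<lambda>\<omega>. (\<omega>, v)) -` W) = ennreal (success_prob p \<epsilon> q alg (?A v))"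
        by (simp add: success_prob_def S.emeasure_eq_measure)
      moreover have "s \<le> success_prob p \<epsilon> q alg (?A v)" using success by simp
      ultimately show ?thesis using True by (simp add: ennreal_leI)
    qed simp
  qed
  also have "\<dots> = emeasure (?S \<Otimes>\<^sub>M gauss m) W"
    by (rule SG.emeasure_pair_measure_alt2[OF W, symmetric])
  \<comment> \<open>The seed moves to the outer integral, so the inner one concerns a deterministic
    algorithm.\<close>
  also have "\<dots> = (\<integral>\<^sup>+\<omega>. emeasure (gauss m) (Pair \<omega> -` W) \<partial>?S)"
    by (rule G.emeasure_pair_measure_alt[OF W])
  also have "\<dots> \<le> (\<integral>\<^sup>+\<omega>. ennreal b \<partial>?S)"
  proof (rule nn_integral_mono)
    fix \<omega> assume \<omega>: "\<omega> \<in> space ?S"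
    let ?V = "Pair \<omega> -` W"
    \<comment> \<open>Equal transcripts give equal estimates; squared norms up to
      \<open>2 * real m\<close> turn the factor 4 into 8. At \<open>j = q\<close> the common
      transcript is the empty one.\<close>
    have "pins_norm (8 * \<epsilon> * real m) m q ?V"
    proof (rule pins_norm_transcript[OF alg _ \<omega>])
      fix v w assume vw: "v \<in> ?V" "w \<in> ?V" "transcript alg (?A v) \<omega> q = transcript alg (?A w) \<omega> q"
      then have "\<bar>(?r v)\<^sup>2 - (?r w)\<^sup>2\<bar> \<le> 4 * \<epsilon> * (2 * real m)"
        using \<epsilon> by (intro abs_diff_power2_le[of "?e \<omega> v"]) (auto simp: W_def sum_nonneg)
      then show "\<bar>(\<Sum>i<m. (v i)\<^sup>2) - (\<Sum>i<m. (w i)\<^sup>2)\<bar> \<le> 8 * \<epsilon> * real m"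
        by (simp add: sum_nonneg)
    next
      show "?V \<subseteq> space (gauss m)" by (auto simp: W_def space_pair_measure)
      show "transcript alg (?A v) \<omega> (q - q) = (\<lambda>_. undefined)" for v by simp
    qed (use mn in \<open>auto simp: m_def\<close>)
    then show "emeasure (gauss m) (Pair \<omega> -` W) \<le> ennreal b"
      using sets_Pair1[OF W, of \<omega>] small unfolding m_def by (intro emeasure_pins_norm_le) auto
  qed
  also have "\<dots> = ennreal b"
    by (simp add: S.emeasure_space_1)
  finally show ?thesis .
qed

section \<open>Algorithms without queries\<close>

text \<open>The output cannot depend on the matrix, so instances with disjoint acceptance intervals
  have disjoint success events; infinitely many of probability at least \<open>s > 0\<close> cannot
  coexist.\<close>

lemma no_queries_fail:
  assumes alg: "matvec_algorithm n 0 alg" and n: "0 < n" and p: "1 \<le> p" and \<epsilon>: "0 \<le> \<epsilon>" "\<epsilon> < 1"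
    and success: "\<forall>A\<in>carrier_mat n n. s \<le> success_prob p \<epsilon> 0 alg A"
  shows "s \<le> 0"
proof (rule ccontr)
  assume "\<not> s \<le> 0"
  then have s: "0 < s" by simp
  let ?S = "seed_space alg"
  interpret S: prob_space ?S using alg by (simp add: matvec_algorithm_def)
  \<comment> \<open>The ratio makes \<open>(1 - \<epsilon>) * R = 2\<close> exceed
    \<open>1 + \<epsilon>\<close>, which separates the acceptance intervals around consecutive
    powers.\<close>
  define R where "R = 2 / (1 - \<epsilon>)"
  have R: "(1 - \<epsilon>) * R = 2" "1 \<le> R" using \<epsilon> by (auto simp: R_def field_simps)
  let ?A = "\<lambda>j. first_row_mat n 1 (\<lambda>_. R ^ j)"
  define E where "E j = {\<omega> \<in> space ?S. \<bar>estimate alg \<omega> (\<lambda>_. undefined) - R ^ j\<bar> \<le> \<epsilon> * R ^ j}" for j :: nat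
  have "schatten_norm p (?A j) = R ^ j" for j
    using n p R by (subst schatten_norm_first_row_mat) auto
  then have E: "s \<le> measure ?S (E j)" for j
    using success[rule_format, of "?A j"] by (simp add: success_prob_def E_def)
  have "E i \<inter> E j = {}" if "i < j" for i j
  proof (rule ccontr)
    assume "E i \<inter> E j \<noteq> {}"
    then obtain \<omega> where "\<omega> \<in> E i" "\<omega> \<in> E j" by auto
    then have "(1 - \<epsilon>) * R ^ j \<le> (1 + \<epsilon>) * R ^ i"
      by (simp add: E_def abs_le_iff algebra_simps)
    also have "\<dots> < 2 * R ^ i" using \<epsilon> R by (intro mult_strict_right_mono) auto
    also have "\<dots> = (1 - \<epsilon>) * R ^ Suc i" using R(1) by (simp add: mult.assoc[symmetric])
    also have "\<dots> \<le> (1 - \<epsilon>) * R ^ j"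
      using \<epsilon> R that by (intro mult_left_mono power_increasing) auto
    finally show False by simp
  qed
  then have disj: "disjoint_family E"
    unfolding disjoint_family_on_def by (metis Int_commute linorder_neqE_nat)
  \<comment> \<open>A set outside the sigma-algebra has measure 0 by convention, so the positive
    lower bound forces measurability.\<close>
  have sets: "E j \<in> sets ?S" for j
    using E[of j] s measure_notin_sets[of "E j" ?S] by fastforce
  obtain N :: nat where "1 / s < real N" using reals_Archimedean2 by blast
  then have "1 < real N * s" using s by (simp add: field_simps)
  also have "\<dots> = (\<Sum>j<N. s)" by simp
  also have "\<dots> \<le> (\<Sum>j<N. measure ?S (E j))" by (intro sum_mono E)
  also have "\<dots> = measure ?S (\<Union>j<N. E j)"
    using disj sets by (intro S.finite_measure_finite_Union[symmetric])
      (auto intro: disjoint_family_on_mono)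
  also have "\<dots> \<le> 1" by (rule S.prob_le_1)
  finally show False by simp
qed

section \<open>Choice of constants and the two regimes of accuracy\<close>

theorem corollary7p3:
  fixes s :: real
  assumes "0 < s" and "s \<le> 1"
  shows "\<exists>c>0. \<exists>C>0. \<forall>(p::ereal) (\<epsilon>::real) (n::nat) (q::nat) (alg :: 'r matvec_alg).
    1 \<le> p \<longrightarrow> 0 < \<epsilon> \<longrightarrow> \<epsilon> < 1 \<longrightarrow> C / \<epsilon>\<^sup>2 \<le> real n \<longrightarrow>
    matvec_algorithm n q alg \<longrightarrow>
    (\<forall>A\<in>carrier_mat n n. s \<le> success_prob p \<epsilon> q alg A) \<longrightarrow>
    c / \<epsilon>\<^sup>2 \<le> real q"
proof -
  \<comment> \<open>\<open>s / 4\<close> lies strictly below the \<open>s / 2\<close> that success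
    would force.\<close>
  obtain h where "0 < h" "\<forall>\<^sub>F k in sequentially. \<forall>u.
      emeasure (gauss k) {z \<in> space (gauss k). \<bar>(\<Sum>i<k. (z i)\<^sup>2) - u\<bar> \<le> h * sqrt (real k)} \<le> ennreal (s / 4)"
    using emeasure_gauss_window[of "s / 4"] assms by auto
  then obtain K where h: "0 < h" and window: "\<And>k u. K \<le> k \<Longrightarrow>
      emeasure (gauss k) {z \<in> space (gauss k). \<bar>(\<Sum>i<k. (z i)\<^sup>2) - u\<bar> \<le> h * sqrt (real k)} \<le> ennreal (s / 4)"
    by (auto simp: eventually_sequentially)
  \<comment> \<open>The bound 1 keeps \<open>m \<le> n\<close> when \<open>C = 1\<close>; 128 = 64 *
    2 comes from squaring \<open>8 * \<epsilon> * real m\<close> and from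
    \<open>m \<le> 2 * k\<close>.\<close>
  define \<kappa> where "\<kappa> = min 1 (h\<^sup>2 / 128)"
  \<comment> \<open>For \<open>\<epsilon>\<^sup>2 \<le> c\<close> this makes
    \<open>\<kappa> / \<epsilon>\<^sup>2\<close> at least \<open>4 * (K + 1)\<close>, which leaves
    \<open>k \<ge> K\<close> degrees of freedom, and it keeps \<open>q\<close> below a quarter of
    that ratio.\<close>
  define c where "c = \<kappa> / (4 * (real K + 1))"
  have \<kappa>: "0 < \<kappa>" "\<kappa> \<le> 1" "128 * \<kappa> \<le> h\<^sup>2" using h by (auto simp: \<kappa>_def)
  have c: "0 < c" "4 * (real K + 1) * c = \<kappa>" "4 * c \<le> \<kappa>"
    using \<kappa> by (auto simp: c_def field_simps)
  show ?thesis
  proof (rule exI[of _ c], rule conjI[OF c(1)], rule exI[of _ 1], intro conjI allI impI)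
    fix p :: ereal and \<epsilon> :: real and n q :: nat and alg :: "'r matvec_alg"
    assume p: "1 \<le> p" and \<epsilon>: "0 < \<epsilon>" "\<epsilon> < 1" and n: "1 / \<epsilon>\<^sup>2 \<le> real n"
      and alg: "matvec_algorithm n q alg"
      and success: "\<forall>A\<in>carrier_mat n n. s \<le> success_prob p \<epsilon> q alg A"
    have n0: "0 < n"
    proof (rule ccontr)
      assume "\<not> 0 < n"
      with n \<epsilon> show False by (simp add: divide_le_0_iff)
    qed
    show "c / \<epsilon>\<^sup>2 \<le> real q"
    proof (cases "\<epsilon>\<^sup>2 \<le> c")
      \<comment> \<open>Here \<open>c / \<epsilon>\<^sup>2 < 1\<close>, so a single query already
        meets the bound.\<close>
      case False
      have "q \<noteq> 0"
      proof
        assume q: "q = 0"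
        show False
          using no_queries_fail[OF alg[unfolded q] n0 p _ _ success[unfolded q]] \<epsilon> assms by simp
      qed
      then have "1 \<le> real q" by simp
      moreover have "c / \<epsilon>\<^sup>2 \<le> 1" using False \<epsilon> by simp
      ultimately show ?thesis by linarith
    next
      case True
      show ?thesis
      proof (rule ccontr)
        assume "\<not> c / \<epsilon>\<^sup>2 \<le> real q"
        then have q: "real q < c / \<epsilon>\<^sup>2" by simp
        define x where "x = \<kappa> / \<epsilon>\<^sup>2"
        define m where "m = nat \<lfloor>x\<rfloor>"
        have "4 * (real K + 1) * 1 \<le> 4 * (real K + 1) * (c / \<epsilon>\<^sup>2)"
          using True \<epsilon> by (intro mult_left_mono) auto
        also have "\<dots> = x" by (simp add: x_def c(2)[symmetric])
        finally have xK: "4 * real K + 4 \<le> x" by simp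
        then have "4 \<le> x" by (rule order_trans[rotated]) simp
        have "4 * (c / \<epsilon>\<^sup>2) \<le> x"
          unfolding x_def times_divide_eq_right using c(3) by (intro divide_right_mono) auto
        with q have qx: "4 * real q < x" by simp
        have m: "real m \<le> x" "x < real m + 1"
          using xK by (auto simp: m_def)
        \<comment> \<open>\<open>q\<close> is below \<open>x / 4\<close>; the slack up to one half
          absorbs the rounding of \<open>x\<close>.\<close>
        have "real q \<le> real m / 2" using qx m \<open>4 \<le> x\<close> by linarith
        then have qm: "q \<le> m" by linarith
        define k where "k = m - q"
        have k: "m = q + k" using qm by (simp add: k_def)
        have mk: "real m \<le> 2 * real k" using \<open>real q \<le> real m / 2\<close> k by simp
        have "real K \<le> real k" using mk m xK by linarith
        then have "K \<le> k" by simp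
        have "real m \<le> real n"
        proof -
          have "x \<le> 1 / \<epsilon>\<^sup>2" unfolding x_def using \<kappa>(2) by (intro divide_right_mono) auto
          with m n show ?thesis by linarith
        qed
        have "8 * \<epsilon> * real m \<le> h * sqrt (real k)"
        proof (rule power2_le_imp_le)
          have "\<epsilon>\<^sup>2 * real m \<le> \<epsilon>\<^sup>2 * x" using m by (intro mult_left_mono) auto
          also have "\<dots> = \<kappa>" using \<epsilon> by (simp add: x_def)
          finally have "64 * (\<epsilon>\<^sup>2 * real m) * real m \<le> 64 * \<kappa> * (2 * real k)"
            using mk \<kappa> by (intro mult_mono) auto
          also have "\<dots> = 128 * \<kappa> * real k" by simp
          also have "\<dots> \<le> h\<^sup>2 * real k" using \<kappa>(3) by (intro mult_right_mono) auto
          finally show "(8 * \<epsilon> * real m)\<^sup>2 \<le> (h * sqrt (real k))\<^sup>2"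
            by (simp add: power2_eq_square mult_ac)
        qed (use h in simp)
        then have small: "emeasure (gauss k)
            {z \<in> space (gauss k). \<bar>(\<Sum>i<k. (z i)\<^sup>2) - u\<bar> \<le> 8 * \<epsilon> * real (q + k)} \<le> ennreal (s / 4)" for u
          unfolding k
          by (intro order_trans[OF emeasure_mono window[OF \<open>K \<le> k\<close>, of u]]) auto
        have "q + k \<le> n" "0 < q + k"
          using \<open>real m \<le> real n\<close> m \<open>4 \<le> x\<close> k by auto
        then have "ennreal (s / 2) \<le> ennreal (s / 4)"
          using success_prob_lower_bound[OF alg _ _ p _ success _ small] \<epsilon> assms by simp
        with assms show False by simp
      qed
    qed
  qed simp
qed

end
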